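(* Let $\{x_1,\dots,x_n\}$ be a basis for $\Lambda_{\mathbb K}$, regarded as a generating set for $S_q(\Lambda_{\mathbb K})$, and let $\{\partial_1,\dots,\partial_n\}$ be the dual basis for $\Lambda^*_{\mathbb K}$, regarded as a generating set for $S_q(\Lambda^*_{\mathbb K})$. The braided Heisenberg double $\mathfrak h(S_q(\Lambda_{\mathbb K}),S_q(\Lambda_{\mathbb K}^* ))$ is the algebra isomorphic to $S_q(\Lambda_{\mathbb K})\otimes S_q(\Lambda_{\mathbb K}^* )$ as a vector space (module over the coefficients), with relations $$x_i x_j-q_{ij}x_jx_i=0,\qquad \partial_i\partial_j-q_{ij}\partial_j\partial_i=0\qquad\text{for all } i\neq j,$$ $$\partial_i x_j-q_{ij}^{-1}x_j\partial_i-\delta_{ij}=0\qquad\text{for all }1\le i,j\le n .$$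
   Context: $\mathbb K$ is an algebraically closed field of characteristic $0$ and $T\cong\mathbb G_m^n$ is a torus with cocharacter lattice $\Lambda\cong\mathbb Z^n$; $\Lambda_{\mathbb K}=\Lambda\otimes_{\mathbb Z}\mathbb K$, $\Lambda^*_{\mathbb K}=\Lambda^*\otimes_{\mathbb Z}\mathbb K$. Let $q_{ij}=q^{m_{ij}}$, where $M=[m_{ij}]$ is an $n\times n$ matrix of parameters with $m_{ji}=-m_{ij}$ for $i\ne j$ (the $m_{ii}$ are unrestricted). So the $q_{ij}$ are invertible parameters (formal, or specialized to a commutative $\mathbb K$-algebra of coefficients) with $q_{ji}=q_{ij}^{-1}$ for $i\neq j$; all vector spaces and tensor products are taken over the coefficients. $\mathrm{Rep}_q(T)$ is the category of $\mathcal O(T)$-comodules, i.e. $\mathbb Z^n$-graded modules, with braiding on homogeneous elements $\sigma(v\otimes w)=q^{\deg(v)\,M\,\deg(w)^t}\,w\otimes v=\prod_{i,j}q_{ij}^{\deg(v)_i\deg(w)_j}\,w\otimes v$. The element $x_i$ has degree $e_i$ and $\partial_i$ has degree $-e_i$. $S_q(\Lambda_{\mathbb K})$ is the quotient of the tensor algebra $T(\Lambda_{\mathbb K})$ by the relations $x_i\otimes x_j-\sigma(x_i\otimes x_j)$, $i\ne j$ (no relation is imposed for $i=j$). $S_q(\Lambda^*_{\mathbb K})$ is defined in the same way from the $\partial_i$. Both are braided Hopf algebras in $\mathrm{Rep}_q(T)$ with generators primitive: for a generator $g$, $\Delta(g)=g\otimes 1+1\otimes g$, $\epsilon(g)=0$,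 $S(g)=-g$, where $\Delta$ is multiplicative for the product $(m\otimes m)\circ(\mathrm{id}\otimes\sigma\otimes\mathrm{id})$ on a tensor product of algebras. With $H=S_q(\Lambda_{\mathbb K})$ and $H'=S_q(\Lambda_{\mathbb K}^* )$, let $\langle -,-\rangle:H'\otimes H\to\mathbf 1$ be the Hopf pairing extending $\langle\partial_i,x_j\rangle=\delta_{ij}$, that is, the pairing satisfying: - $\langle-,-\rangle\circ (m_{H'}\otimes\mathrm{id})=(\langle-,-\rangle\otimes\langle-,-\rangle)\circ(\mathrm{id}\otimes\sigma_{H',H}\otimes\mathrm{id})\circ(\mathrm{id}\otimes\mathrm{id}\otimes\Delta_{H})$; - $\langle-,-\rangle\circ (\mathrm{id}\otimes m_{H})=(\langle-,-\rangle\otimes\langle-,-\rangle)\circ(\mathrm{id}\otimes\sigma_{H',H}\otimes\mathrm{id})\circ(\Delta_{H'}\otimes\mathrm{id}\otimes\mathrm{id})$; - pairing with the unit of one factor is the counit of the other, and the antipodes are adjoint. The left regular action $\mathrm{act}_l:H'\otimes H\to H$ is the composite $H'\otimes H\xrightarrow{\mathrm{id}\otimes\Delta}H'\otimes H\otimes H\xrightarrow{\mathrm{id}\otimes\sigma_{H,H}}H'\otimes H\otimes H\xrightarrow{\langle-,-\rangle\otimes\mathrm{id}}H$. The braided Heisenberg double $\mathfrak h(H,H')$ is the object $H\otimes H'$ with multiplication the composite $$H\otimes H'\otimes H\otimes H'\xrightarrow{\Delta_2}H\otimes H'\otimes H'\otimes H\otimes H'\xrightarrow{\sigma_{34}}H\otimes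 H'\otimes H\otimes H'\otimes H'\xrightarrow{\mathrm{act}_{l,23}}H\otimes H\otimes H'\otimes H'\xrightarrow{m_H\otimes m_{H'}}H\otimes H',$$ where subscripts indicate the tensor factors to which a map is applied (identity elsewhere).
   Formalization: The statement fails as written when some q_ii^2≠1 (the product is not associative); it is proved for all parameters with σ_{H,H}^{-1} in place of σ_{H,H} in act_l, and for the literal act_l the relations always hold and the presentation holds exactly when q_ii^2=1 for all i. *)

theory Defs
  imports
    "HOL-Library.Poly_Mapping"
    "HOL-Computational_Algebra.Polynomial"
    "HOL-Algebra.Module"
    "HOL-Algebra.QuotRing"
begin

section \<open>Free modules, quotients and tensor products\<close>

text \<open>
  The free module on a set of basis labels \<open>'b\<close> over the coefficient ring \<open>'r\<close> is
  \<open>'b \<Rightarrow>\<^sub>0 'r\<close>; the tensor product of free modules is the free module on pairs of labels.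
  An operator given on basis vectors is extended linearly by \<open>lin\<close>, written \<open>p \<bind> f\<close>
  with the argument first, so that a composite of maps applied to selected tensor factors
  reads from left to right.
\<close>

definition scl :: "'r::comm_ring_1 \<Rightarrow> ('b \<Rightarrow>\<^sub>0 'r) \<Rightarrow> ('b \<Rightarrow>\<^sub>0 'r)" where
  "scl c p = Poly_Mapping.map ((*) c) p"

abbreviation bas :: "'b \<Rightarrow> ('b \<Rightarrow>\<^sub>0 'r::comm_ring_1)" where
  "bas b \<equiv> Poly_Mapping.single b 1"

definition lin :: "('b \<Rightarrow>\<^sub>0 'r::comm_ring_1) \<Rightarrow> ('b \<Rightarrow> ('c \<Rightarrow>\<^sub>0 'r)) \<Rightarrow> ('c \<Rightarrow>\<^sub>0 'r)"
    (infixl \<open>\<bind>\<close> 54) where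
  "p \<bind> f = (\<Sum>b \<in> Poly_Mapping.keys p. scl (Poly_Mapping.lookup p b) (f b))"

definition lin_form :: "('b \<Rightarrow>\<^sub>0 'r::comm_ring_1) \<Rightarrow> ('b \<Rightarrow> 'r) \<Rightarrow> 'r" where
  "lin_form p f = (\<Sum>b \<in> Poly_Mapping.keys p. Poly_Mapping.lookup p b * f b)"

definition tens :: "('b \<Rightarrow>\<^sub>0 'r::comm_ring_1) \<Rightarrow> ('c \<Rightarrow>\<^sub>0 'r) \<Rightarrow> ('b \<times> 'c \<Rightarrow>\<^sub>0 'r)" where
  "tens p p' = p \<bind> (\<lambda>b. p' \<bind> (\<lambda>c. bas (b, c)))"

definition lspan :: "('b \<Rightarrow>\<^sub>0 'r::comm_ring_1) set \<Rightarrow> ('b \<Rightarrow>\<^sub>0 'r) set" where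
  "lspan S = Modules.module.span scl S"

definition cls :: "('b \<Rightarrow>\<^sub>0 'r::comm_ring_1) set \<Rightarrow> ('b \<Rightarrow>\<^sub>0 'r) \<Rightarrow> ('b \<Rightarrow>\<^sub>0 'r) set" where
  "cls N p = {p'. p' - p \<in> N}"

text \<open>
  \<open>(F/N) \<otimes> (F'/N')\<close> is the quotient of \<open>F \<otimes> F'\<close> by the image of \<open>N \<otimes> F' + F \<otimes> N'\<close>.
\<close>
definition tens_rel ::
    "('b \<Rightarrow>\<^sub>0 'r::comm_ring_1) set \<Rightarrow> ('c \<Rightarrow>\<^sub>0 'r) set \<Rightarrow> ('b \<times> 'c \<Rightarrow>\<^sub>0 'r) set" where
  "tens_rel N N' = lspan ({tens p p' | p p'. p \<in> N} \<union> {tens p p' | p p'. p' \<in> N'})"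

text \<open>
  The quotient module \<open>F/N\<close> with the product induced by \<open>\<mu>\<close> and unit the class of \<open>u\<close>. If
  \<open>\<mu>\<close> does not descend to the quotient, some products of cosets fail to be cosets, so a
  bijection onto \<open>F/N\<close> which respects products can exist only for a well-defined product.
\<close>
definition quot_alg ::
    "('b \<Rightarrow>\<^sub>0 'r::comm_ring_1) set \<Rightarrow> (('b \<Rightarrow>\<^sub>0 'r) \<Rightarrow> ('b \<Rightarrow>\<^sub>0 'r) \<Rightarrow> ('b \<Rightarrow>\<^sub>0 'r)) \<Rightarrow>
     ('b \<Rightarrow>\<^sub>0 'r) \<Rightarrow> ('r, ('b \<Rightarrow>\<^sub>0 'r) set) module" where
  "quot_alg N \<mu> u =
    \<lparr>carrier = {cls N p | p. True},
     mult = (\<lambda>C D. \<Union>p\<in>C. \<Union>p'\<in>D. cls N (\<mu> p p')),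
     one = cls N u,
     zero = cls N 0,
     add = (\<lambda>C D. \<Union>p\<in>C. \<Union>p'\<in>D. cls N (p + p')),
     smult = (\<lambda>c C. \<Union>p\<in>C. cls N (scl c p))\<rparr>"

text \<open>Inverse of a unit of a commutative ring (the type class provides no inverse).\<close>
definition unit_inv :: "'r::comm_ring_1 \<Rightarrow> 'r" where
  "unit_inv u = (THE v. u * v = 1)"

definition unit_powi :: "'r::comm_ring_1 \<Rightarrow> int \<Rightarrow> 'r" where
  "unit_powi u k = (if k \<ge> 0 then u ^ nat k else unit_inv u ^ nat (- k))"


section \<open>Tensor algebras in the braided category\<close>

text \<open>
  The tensor algebra on a module with basis \<open>'a\<close> is the free module on words \<open>'a list\<close>; with
  concatenation as the monoid operation on words, its product is the convolution product
  of \<open>\<Rightarrow>\<^sub>0\<close>.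
\<close>
instantiation list :: (type) monoid_add
begin
definition zero_list :: "'a list" where "zero_list = []"
definition plus_list :: "'a list \<Rightarrow> 'a list \<Rightarrow> 'a list" where "plus_list v w = v @ w"
instance by standard (simp_all add: zero_list_def plus_list_def)
end

definition ideal_gen :: "('a list \<Rightarrow>\<^sub>0 'r::comm_ring_1) set \<Rightarrow> ('a list \<Rightarrow>\<^sub>0 'r) set" where
  "ideal_gen S = lspan {p * s * p' | p s p'. s \<in> S}"

text \<open>
  Degrees lie in \<open>\<int>\<^sup>n\<close>, realised as \<open>'n \<Rightarrow> int\<close>. A map \<open>\<delta>\<close> assigns degrees to the letters:
  \<open>deg_x i = e\<^sub>i\<close> for \<open>x\<^sub>i\<close> and \<open>deg_d i = - e\<^sub>i\<close> for \<open>\<partial>\<^sub>i\<close>.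
\<close>
definition deg_x :: "'n \<Rightarrow> 'n \<Rightarrow> int" where
  "deg_x i j = (if i = j then 1 else 0)"

definition deg_d :: "'n \<Rightarrow> 'n \<Rightarrow> int" where
  "deg_d i j = (if i = j then - 1 else 0)"

definition deg :: "('a \<Rightarrow> 'n \<Rightarrow> int) \<Rightarrow> 'a list \<Rightarrow> 'n \<Rightarrow> int" where
  "deg \<delta> w j = (\<Sum>a\<leftarrow>w. \<delta> a j)"

definition bichar :: "('n::finite \<Rightarrow> 'n \<Rightarrow> 'r::comm_ring_1) \<Rightarrow> ('n \<Rightarrow> int) \<Rightarrow> ('n \<Rightarrow> int) \<Rightarrow> 'r" where
  "bichar q d d' = (\<Prod>i\<in>UNIV. \<Prod>j\<in>UNIV. unit_powi (q i j) (d i * d' j))"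

text \<open>
  \<open>braid q \<delta> \<delta>'\<close> is the braiding \<open>T(V) \<otimes> T(W) \<rightarrow> T(W) \<otimes> T(V)\<close> on basis vectors, where the letters
  of \<open>V\<close> and \<open>W\<close> have degrees \<open>\<delta>\<close> and \<open>\<delta>'\<close>; \<open>braid_inv q \<delta> \<delta>'\<close> is the inverse of the
  braiding \<open>T(W) \<otimes> T(V) \<rightarrow> T(V) \<otimes> T(W)\<close>, a map with the same source and target.
\<close>
definition braid :: "('n::finite \<Rightarrow> 'n \<Rightarrow> 'r::comm_ring_1) \<Rightarrow> ('a \<Rightarrow> 'n \<Rightarrow> int) \<Rightarrow> ('b \<Rightarrow> 'n \<Rightarrow> int) \<Rightarrow>
    'a list \<times> 'b list \<Rightarrow> ('b list \<times> 'a list \<Rightarrow>\<^sub>0 'r)" where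
  "braid q \<delta> \<delta>' = (\<lambda>(v, w). scl (bichar q (deg \<delta> v) (deg \<delta>' w)) (bas (w, v)))"

definition braid_inv :: "('n::finite \<Rightarrow> 'n \<Rightarrow> 'r::comm_ring_1) \<Rightarrow> ('a \<Rightarrow> 'n \<Rightarrow> int) \<Rightarrow> ('b \<Rightarrow> 'n \<Rightarrow> int) \<Rightarrow>
    'a list \<times> 'b list \<Rightarrow> ('b list \<times> 'a list \<Rightarrow>\<^sub>0 'r)" where
  "braid_inv q \<delta> \<delta>' = (\<lambda>(v, w). scl (unit_inv (bichar q (deg \<delta>' w) (deg \<delta> v))) (bas (w, v)))"

definition mul :: "'a list \<times> 'a list \<Rightarrow> ('a list \<Rightarrow>\<^sub>0 'r::comm_ring_1)" where
  "mul = (\<lambda>(v, w). bas v * bas w)"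

text \<open>The kernel of \<open>T(V) \<rightarrow> S\<^sub>q(V)\<close>; \<open>\<delta> = deg_x\<close> gives \<open>H\<close> and \<open>\<delta> = deg_d\<close> gives \<open>H'\<close>.\<close>
definition sq_ideal :: "('n::finite \<Rightarrow> 'n \<Rightarrow> 'r::comm_ring_1) \<Rightarrow> ('n \<Rightarrow> 'n \<Rightarrow> int) \<Rightarrow> ('n list \<Rightarrow>\<^sub>0 'r) set" where
  "sq_ideal q \<delta> = ideal_gen {mul ([i], [j]) - (braid q \<delta> \<delta> ([i], [j]) \<bind> mul) | i j. i \<noteq> j}"

text \<open>
  The structure maps of \<open>S\<^sub>q(V)\<close> are induced by the following maps on \<open>T(V)\<close>, which are
  determined by their values on generators: \<open>\<Delta>\<close> is an algebra map into \<open>T(V) \<otimes> T(V)\<close> with the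
  product \<open>(m \<otimes> m) \<circ> (id \<otimes> \<sigma> \<otimes> id)\<close>, \<open>\<epsilon>\<close> is an algebra map, and \<open>S \<circ> m = m \<circ> \<sigma> \<circ> (S \<otimes> S)\<close>.
\<close>
definition braided_mul :: "('n::finite \<Rightarrow> 'n \<Rightarrow> 'r::comm_ring_1) \<Rightarrow> ('a \<Rightarrow> 'n \<Rightarrow> int) \<Rightarrow>
    ('a list \<times> 'a list \<Rightarrow>\<^sub>0 'r) \<Rightarrow> ('a list \<times> 'a list \<Rightarrow>\<^sub>0 'r) \<Rightarrow> ('a list \<times> 'a list \<Rightarrow>\<^sub>0 'r)" where
  "braided_mul q \<delta> P P' =
    P \<bind> (\<lambda>(a, b). P' \<bind> (\<lambda>(c, d).
      braid q \<delta> \<delta> (b, c) \<bind> (\<lambda>(c', b'). tens (mul (a, c')) (mul (b', d)))))"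

primrec comul :: "('n::finite \<Rightarrow> 'n \<Rightarrow> 'r::comm_ring_1) \<Rightarrow> ('a \<Rightarrow> 'n \<Rightarrow> int) \<Rightarrow>
    'a list \<Rightarrow> ('a list \<times> 'a list \<Rightarrow>\<^sub>0 'r)" where
  "comul q \<delta> [] = tens 1 1"
| "comul q \<delta> (a # w) = braided_mul q \<delta> (tens (bas [a]) 1 + tens 1 (bas [a])) (comul q \<delta> w)"

primrec counit :: "'a list \<Rightarrow> 'r::comm_ring_1" where
  "counit [] = 1"
| "counit (a # w) = 0 * counit w"

primrec antipode :: "('n::finite \<Rightarrow> 'n \<Rightarrow> 'r::comm_ring_1) \<Rightarrow> ('a \<Rightarrow> 'n \<Rightarrow> int) \<Rightarrow>
    'a list \<Rightarrow> ('a list \<Rightarrow>\<^sub>0 'r)" where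
  "antipode q \<delta> [] = 1"
| "antipode q \<delta> (a # w) = tens (- bas [a]) (antipode q \<delta> w) \<bind> braid q \<delta> \<delta> \<bind> mul"


section \<open>The Hopf pairing and the braided Heisenberg double\<close>

text \<open>
  A pairing is given by its values \<open>pr f h\<close> on a word \<open>f\<close> in the \<open>\<partial>\<^sub>i\<close> and a word \<open>h\<close> in the
  \<open>x\<^sub>i\<close>. The first assumption says that it is a morphism in \<open>Rep\<^sub>q(T)\<close>, i.e. of degree \<open>0\<close>; the
  next two that its bilinear extension factors through \<open>H' \<otimes> H\<close>.
\<close>
definition pair_ext :: "('n list \<Rightarrow> 'n list \<Rightarrow> 'r::comm_ring_1) \<Rightarrow>
    ('n list \<Rightarrow>\<^sub>0 'r) \<Rightarrow> ('n list \<Rightarrow>\<^sub>0 'r) \<Rightarrow> 'r" where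
  "pair_ext pr F G = lin_form (tens F G) (\<lambda>(f, h). pr f h)"

definition hopf_pairing :: "('n::finite \<Rightarrow> 'n \<Rightarrow> 'r::comm_ring_1) \<Rightarrow>
    ('n list \<Rightarrow> 'n list \<Rightarrow> 'r) \<Rightarrow> bool" where
  "hopf_pairing q pr \<longleftrightarrow>
    (\<forall>f h. (\<exists>j. deg deg_d f j + deg deg_x h j \<noteq> 0) \<longrightarrow> pr f h = 0) \<and>
    (\<forall>F G. F \<in> sq_ideal q deg_d \<longrightarrow> pair_ext pr F G = 0) \<and>
    (\<forall>F G. G \<in> sq_ideal q deg_x \<longrightarrow> pair_ext pr F G = 0) \<and>
    (\<forall>i j. pr [i] [j] = (if i = j then 1 else 0)) \<and>
    (\<forall>f g h. pair_ext pr (mul (f, g)) (bas h) =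
      lin_form (comul q deg_x h) (\<lambda>(h1, h2).
        lin_form (braid q deg_d deg_x (g, h1)) (\<lambda>(h1', g'). pr f h1' * pr g' h2))) \<and>
    (\<forall>f h k. pair_ext pr (bas f) (mul (h, k)) =
      lin_form (comul q deg_d f) (\<lambda>(f1, f2).
        lin_form (braid q deg_d deg_x (f2, h)) (\<lambda>(h', f2'). pr f1 h' * pr f2' k))) \<and>
    (\<forall>h. pr [] h = counit h) \<and>
    (\<forall>f. pr f [] = counit f) \<and>
    (\<forall>f h. pair_ext pr (antipode q deg_d f) (bas h) = pair_ext pr (bas f) (antipode q deg_x h))"

text \<open>
  The left regular action, with the map \<open>\<beta>\<close> in the place of \<open>\<sigma>\<^sub>H\<^sub>,\<^sub>H\<close>. The definition with
  \<open>\<beta> = \<sigma>\<^sub>H\<^sub>,\<^sub>H\<close> is an action of \<open>H'\<close> only if \<open>q\<^sub>i\<^sub>i\<^sup>2 = 1\<close> for all \<open>i\<close>: already in rank one with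
  \<open>q = q\<^sub>1\<^sub>1\<close>, \<open>\<partial>\<close> sends \<open>x\<^sup>2\<close> to \<open>q (1 + q) x\<close> while \<open>\<langle>\<partial>\<^sup>2, x\<^sup>2\<rangle> = 1 + q\<^sup>-\<^sup>1\<close>. With the inverse of
  \<open>\<sigma>\<^sub>H\<^sub>,\<^sub>H\<close> it is an action for all \<open>q\<close>.
\<close>
definition act_l :: "('n::finite \<Rightarrow> 'n \<Rightarrow> 'r::comm_ring_1) \<Rightarrow> ('n list \<Rightarrow> 'n list \<Rightarrow> 'r) \<Rightarrow>
    ('n list \<times> 'n list \<Rightarrow> ('n list \<times> 'n list \<Rightarrow>\<^sub>0 'r)) \<Rightarrow> 'n list \<times> 'n list \<Rightarrow> ('n list \<Rightarrow>\<^sub>0 'r)" where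
  "act_l q pr \<beta> = (\<lambda>(f, h).
    comul q deg_x h \<bind> \<beta> \<bind> (\<lambda>(h', h''). scl (pr f h') (bas h'')))"

definition heis_mul :: "('n::finite \<Rightarrow> 'n \<Rightarrow> 'r::comm_ring_1) \<Rightarrow> ('n list \<Rightarrow> 'n list \<Rightarrow> 'r) \<Rightarrow>
    ('n list \<times> 'n list \<Rightarrow> ('n list \<times> 'n list \<Rightarrow>\<^sub>0 'r)) \<Rightarrow>
    ('n list \<times> 'n list \<Rightarrow>\<^sub>0 'r) \<Rightarrow> ('n list \<times> 'n list \<Rightarrow>\<^sub>0 'r) \<Rightarrow> ('n list \<times> 'n list \<Rightarrow>\<^sub>0 'r)" where
  "heis_mul q pr \<beta> P P' =
    P \<bind> (\<lambda>(h, f). P' \<bind> (\<lambda>(k, g).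
      comul q deg_d f \<bind> (\<lambda>(f1, f2).
        braid q deg_d deg_x (f2, k) \<bind> (\<lambda>(k', f2').
          act_l q pr \<beta> (f1, k') \<bind> (\<lambda>k''. tens (mul (h, k'')) (mul (f2', g)))))))"

definition heis :: "('n::finite \<Rightarrow> 'n \<Rightarrow> 'r::comm_ring_1) \<Rightarrow> ('n list \<Rightarrow> 'n list \<Rightarrow> 'r) \<Rightarrow>
    ('n list \<times> 'n list \<Rightarrow> ('n list \<times> 'n list \<Rightarrow>\<^sub>0 'r)) \<Rightarrow> ('r, ('n list \<times> 'n list \<Rightarrow>\<^sub>0 'r) set) module" where
  "heis q pr \<beta> =
    quot_alg (tens_rel (sq_ideal q deg_x) (sq_ideal q deg_d)) (heis_mul q pr \<beta>) (tens 1 1)"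

definition heis_x :: "('n::finite \<Rightarrow> 'n \<Rightarrow> 'r::comm_ring_1) \<Rightarrow> 'n \<Rightarrow> ('n list \<times> 'n list \<Rightarrow>\<^sub>0 'r) set" where
  "heis_x q i = cls (tens_rel (sq_ideal q deg_x) (sq_ideal q deg_d)) (tens (bas [i]) 1)"

definition heis_d :: "('n::finite \<Rightarrow> 'n \<Rightarrow> 'r::comm_ring_1) \<Rightarrow> 'n \<Rightarrow> ('n list \<times> 'n list \<Rightarrow>\<^sub>0 'r) set" where
  "heis_d q i = cls (tens_rel (sq_ideal q deg_x) (sq_ideal q deg_d)) (tens 1 (bas [i]))"


section \<open>The presentation\<close>

datatype 'n gen = X 'n | D 'n

definition pres_rels :: "('n \<Rightarrow> 'n \<Rightarrow> 'r::comm_ring_1) \<Rightarrow> ('n gen list \<Rightarrow>\<^sub>0 'r) set" where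
  "pres_rels q =
    {bas [X i] * bas [X j] - scl (q i j) (bas [X j] * bas [X i]) | i j. i \<noteq> j} \<union>
    {bas [D i] * bas [D j] - scl (q i j) (bas [D j] * bas [D i]) | i j. i \<noteq> j} \<union>
    {bas [D i] * bas [X j] - scl (unit_inv (q i j)) (bas [X j] * bas [D i])
       - (if i = j then 1 else 0) | i j. True}"

definition pres_alg :: "('n \<Rightarrow> 'n \<Rightarrow> 'r::comm_ring_1) \<Rightarrow> ('r, ('n gen list \<Rightarrow>\<^sub>0 'r) set) module" where
  "pres_alg q = quot_alg (ideal_gen (pres_rels q)) (*) 1"

text \<open>
  \<open>heis q pr \<beta>\<close> is the algebra on the generators \<open>x\<^sub>i \<otimes> 1\<close> and \<open>1 \<otimes> \<partial>\<^sub>i\<close> with the relations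
  \<open>pres_rels\<close>. Its underlying module is \<open>H \<otimes> H'\<close> by definition.
\<close>
definition heis_presented :: "('n::finite \<Rightarrow> 'n \<Rightarrow> 'r::comm_ring_1) \<Rightarrow> ('n list \<Rightarrow> 'n list \<Rightarrow> 'r) \<Rightarrow>
    ('n list \<times> 'n list \<Rightarrow> ('n list \<times> 'n list \<Rightarrow>\<^sub>0 'r)) \<Rightarrow> bool" where
  "heis_presented q pr \<beta> \<longleftrightarrow>
    (\<exists>\<Phi> \<in> ring_iso (pres_alg q) (heis q pr \<beta>).
      (\<forall>c. \<forall>a \<in> carrier (pres_alg q).
         \<Phi> (c \<odot>\<^bsub>pres_alg q\<^esub> a) = c \<odot>\<^bsub>heis q pr \<beta>\<^esub> \<Phi> a) \<and>
      (\<forall>i. \<Phi> (cls (ideal_gen (pres_rels q)) (bas [X i])) = heis_x q i) \<and>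
      (\<forall>i. \<Phi> (cls (ideal_gen (pres_rels q)) (bas [D i])) = heis_d q i))"

text \<open>The relations alone, for the elements \<open>x\<^sub>i \<otimes> 1\<close> and \<open>1 \<otimes> \<partial>\<^sub>i\<close>.\<close>
definition heis_relations :: "('n::finite \<Rightarrow> 'n \<Rightarrow> 'r::comm_ring_1) \<Rightarrow> ('n list \<Rightarrow> 'n list \<Rightarrow> 'r) \<Rightarrow>
    ('n list \<times> 'n list \<Rightarrow> ('n list \<times> 'n list \<Rightarrow>\<^sub>0 'r)) \<Rightarrow> bool" where
  "heis_relations q pr \<beta> \<longleftrightarrow>
    (let h = heis q pr \<beta>; x = heis_x q; d = heis_d q in
      (\<forall>i j. i \<noteq> j \<longrightarrow> x i \<otimes>\<^bsub>h\<^esub> x j = q i j \<odot>\<^bsub>h\<^esub> (x j \<otimes>\<^bsub>h\<^esub> x i)) \<and>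
      (\<forall>i j. i \<noteq> j \<longrightarrow> d i \<otimes>\<^bsub>h\<^esub> d j = q i j \<odot>\<^bsub>h\<^esub> (d j \<otimes>\<^bsub>h\<^esub> d i)) \<and>
      (\<forall>i j. d i \<otimes>\<^bsub>h\<^esub> x j =
         unit_inv (q i j) \<odot>\<^bsub>h\<^esub> (x j \<otimes>\<^bsub>h\<^esub> d i) \<oplus>\<^bsub>h\<^esub> (if i = j then \<one>\<^bsub>h\<^esub> else \<zero>\<^bsub>h\<^esub>)))"

end

theory Submission
  imports Defs "HOL-Library.Function_Algebras"
begin

text \<open>
  With the inverse braiding, \<open>\<partial>\<^sub>i\<close> acts on words in the \<open>x\<^sub>j\<close> by the skew Leibniz rule
  \<open>\<partial>\<^sub>i (x\<^sub>j h) = q\<^sub>i\<^sub>j\<^sup>-\<^sup>1 x\<^sub>j (\<partial>\<^sub>i h) + \<delta>\<^sub>i\<^sub>j h\<close>, and words in the \<open>\<partial>\<^sub>i\<close> act by composition. Hence, already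
  on \<open>T(V) \<otimes> T(V\<^sup>*)\<close>, left multiplication by \<open>h \<otimes> f\<close> is a composite of the left multiplications by
  generators, and evaluating a word in the generators as such a composite at \<open>1 \<otimes> 1\<close> is
  multiplicative. This evaluation sends the relations to the relations of \<open>H \<otimes> H'\<close>, and
  \<open>w \<otimes> v \<mapsto> X(w) D(v)\<close> is a section of it which is surjective modulo the relations, because a word
  can be straightened; no basis of \<open>H\<close> is needed.

  If the double for the braiding itself is presented by the relations, it is associative;
  comparing coefficients of \<open>x\<^sub>i\<close> and \<open>x\<^sub>i\<^sup>2\<close> in \<open>(\<partial>\<^sub>i x\<^sub>i) x\<^sub>i\<^sup>m = \<partial>\<^sub>i (x\<^sub>i x\<^sub>i\<^sup>m)\<close> for \<open>m = 1, 2\<close> forces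
  \<open>q\<^sub>i\<^sub>i\<^sup>2 = 1\<close>. Conversely \<open>q\<^sub>i\<^sub>i\<^sup>2 = 1\<close> for all \<open>i\<close> makes the braiding its own inverse.
\<close>

section \<open>Linear algebra over free modules\<close>

lemma lookup_scl [simp]: "Poly_Mapping.lookup (scl c p) b = c * Poly_Mapping.lookup p b"
  by (simp add: scl_def Poly_Mapping.map.rep_eq when_def)

interpretation fm: Modules.module scl
  by unfold_locales (auto intro!: poly_mapping_eqI simp: lookup_add algebra_simps)

lemmas scl_simps [simp] = fm.scale_right_distrib fm.scale_left_distrib fm.scale_right_diff_distrib
  fm.scale_left_diff_distrib

text \<open>Vectors with different supports can be summed over one common finite index set;
  linearity of \<open>lin\<close> in its first argument rests on this.\<close>

lemma lin_superset:
  assumes "finite A" "Poly_Mapping.keys p \<subseteq> A"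
  shows "p \<bind> f = (\<Sum>b\<in>A. scl (Poly_Mapping.lookup p b) (f b))"
  unfolding lin_def using assms
  by (intro sum.mono_neutral_left) (auto simp: in_keys_iff)

lemma lin_add [simp]: "p + p' \<bind> f = (p \<bind> f) + (p' \<bind> f)"
proof -
  let ?A = "Poly_Mapping.keys p \<union> Poly_Mapping.keys p'"
  have "Poly_Mapping.keys (p + p') \<subseteq> ?A" by (rule keys_add)
  then show ?thesis
    by (simp add: lin_superset[of ?A] lookup_add sum.distrib)
qed

lemma lin_scl [simp]: "scl c p \<bind> f = scl c (p \<bind> f)"
proof -
  have "Poly_Mapping.keys (scl c p) \<subseteq> Poly_Mapping.keys p" by (auto simp: in_keys_iff)
  then show ?thesis
    by (simp add: lin_superset[of "Poly_Mapping.keys p"] fm.scale_sum_right)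
qed

lemma module_hom_lin: "module_hom scl scl (\<lambda>p. p \<bind> f)"
  by unfold_locales auto

lemma lin_zero [simp]: "0 \<bind> f = 0"
  by (simp add: lin_def)

lemma lin_diff [simp]: "p - p' \<bind> f = (p \<bind> f) - (p' \<bind> f)"
  by (rule module_hom.diff[OF module_hom_lin])

lemma lin_bas [simp]: "bas b \<bind> f = f b"
  by (simp add: lin_def)

lemma lin_add_right: "p \<bind> (\<lambda>b. f b + g b) = (p \<bind> f) + (p \<bind> g)"
  by (simp add: lin_def sum.distrib)

lemma lin_diff_right: "p \<bind> (\<lambda>b. f b - g b) = (p \<bind> f) - (p \<bind> g)"
  by (simp add: lin_def sum_subtractf)

lemma lin_scl_right: "p \<bind> (\<lambda>b. scl c (f b)) = scl c (p \<bind> f)"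
  by (simp add: lin_def fm.scale_sum_right mult.commute)

lemma lin_zero_right [simp]: "p \<bind> (\<lambda>b. 0) = 0"
  by (simp add: lin_def)

text \<open>With \<open>f = bas\<close> this says that a linear map is the linear extension of its
  values on basis labels, which is how identities of linear maps are reduced to words.\<close>

lemma module_hom_lin_comm:
  assumes "module_hom scl scl F"
  shows "F (p \<bind> f) = (p \<bind> (\<lambda>b. F (f b)))"
  by (simp add: lin_def module_hom.sum[OF assms] module_hom.scale[OF assms])

lemma lin_assoc: "p \<bind> f \<bind> g = (p \<bind> (\<lambda>b. f b \<bind> g))"
  by (rule module_hom_lin_comm[OF module_hom_lin])

lemma lin_bas_right [simp]: "p \<bind> (\<lambda>b. bas b) = p"
proof (rule poly_mapping_eqI)
  fix k
  have "Poly_Mapping.lookup (p \<bind> bas) k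
      = (\<Sum>b\<in>Poly_Mapping.keys p. if b = k then Poly_Mapping.lookup p b else 0)"
    by (simp add: lin_def lookup_sum lookup_single when_def if_distrib cong: if_cong)
  also have "\<dots> = Poly_Mapping.lookup p k"
    by (simp add: in_keys_iff)
  finally show "Poly_Mapping.lookup (p \<bind> bas) k = Poly_Mapping.lookup p k" .
qed

lemma lin_cong:
  assumes "\<And>b. b \<in> Poly_Mapping.keys p \<Longrightarrow> f b = g b"
  shows "(p \<bind> f) = (p \<bind> g)"
  unfolding lin_def by (rule sum.cong) (simp_all add: assms)

lemma lin_commute: "p \<bind> (\<lambda>a. p' \<bind> (\<lambda>b. F a b)) = (p' \<bind> (\<lambda>b. p \<bind> (\<lambda>a. F a b)))"
  unfolding lin_def fm.scale_sum_right
  by (subst sum.swap) (simp add: mult.commute)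

lemma keys_lin: "Poly_Mapping.keys (p \<bind> f) \<subseteq> (\<Union>b\<in>Poly_Mapping.keys p. Poly_Mapping.keys (f b))"
proof
  fix k assume "k \<in> Poly_Mapping.keys (p \<bind> f)"
  then have "(\<Sum>b\<in>Poly_Mapping.keys p. Poly_Mapping.lookup p b * Poly_Mapping.lookup (f b) k) \<noteq> 0"
    by (simp add: in_keys_iff lin_def lookup_sum)
  then obtain b where "b \<in> Poly_Mapping.keys p" "Poly_Mapping.lookup p b * Poly_Mapping.lookup (f b) k \<noteq> 0"
    by (meson sum.neutral)
  then show "k \<in> (\<Union>b\<in>Poly_Mapping.keys p. Poly_Mapping.keys (f b))"
    by (metis UN_I in_keys_iff mult_zero_right)
qed

lemma scl_lin_form: "scl (lin_form p f) v = (p \<bind> (\<lambda>b. scl (f b) v))"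
  by (simp add: lin_form_def lin_def fm.scale_sum_left)

text \<open>A linear form is a linear map into the free module on the single label
  \<open>()\<close>, so its rules are read off from those of \<open>lin\<close>.\<close>

lemma lin_form_eq_lookup: "lin_form p f = Poly_Mapping.lookup (p \<bind> (\<lambda>b. scl (f b) (bas ()))) ()"
  by (simp add: lin_form_def lin_def lookup_sum)

lemma lin_form_simps [simp]:
  "lin_form 0 f = 0"
  "lin_form (p + p') f = lin_form p f + lin_form p' f"
  "lin_form (scl c p) f = c * lin_form p f"
  "lin_form (bas b) f = f b"
  by (simp_all add: lin_form_eq_lookup lookup_add)

lemma lin_form_lin: "lin_form (p \<bind> g) f = lin_form p (\<lambda>b. lin_form (g b) f)"
  unfolding lin_form_eq_lookup[of "p \<bind> g"] lin_form_eq_lookup[of p] lin_assoc scl_lin_form ..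

lemma tens_bas [simp]: "tens (bas a) (bas b) = bas (a, b)"
  by (simp add: tens_def)

lemma tens_linear [simp]:
  "tens 0 p' = 0" "tens p 0 = 0"
  "tens (p1 + p2) p' = tens p1 p' + tens p2 p'"
  "tens p (p1' + p2') = tens p p1' + tens p p2'"
  "tens (p1 - p2) p' = tens p1 p' - tens p2 p'"
  "tens p (p1' - p2') = tens p p1' - tens p p2'"
  "tens (scl c p) p' = scl c (tens p p')"
  "tens p (scl c p') = scl c (tens p p')"
  by (simp_all add: tens_def lin_add_right lin_scl_right lin_diff_right)

lemma tens_lin_left: "tens (p \<bind> f) p' = (p \<bind> (\<lambda>b. tens (f b) p'))"
  by (simp add: tens_def lin_assoc)

lemma tens_lin_right: "tens p (p' \<bind> f) = (p' \<bind> (\<lambda>b. tens p (f b)))"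
  unfolding tens_def lin_assoc by (rule lin_commute)

lemma tens_bas_left: "tens (bas a) p' = (p' \<bind> (\<lambda>b. bas (a, b)))"
  by (simp add: tens_def)

lemma tens_eq_lin: "tens p p' = (p \<bind> (\<lambda>a. tens (bas a) p'))"
  by (simp add: tens_def)

lemma tens_eq_lin': "tens p p' = (p' \<bind> (\<lambda>b. tens p (bas b)))"
  by (simp flip: tens_lin_right)

lemma tens_lin: "tens p p' \<bind> F = (p \<bind> (\<lambda>a. p' \<bind> (\<lambda>b. F (a, b))))"
  by (simp add: tens_def lin_assoc)

lemma lspan_eq: "lspan S = fm.span S"
  by (simp add: lspan_def)

lemma lin_mem_subspace:
  assumes "fm.subspace N" "\<And>b. b \<in> Poly_Mapping.keys p \<Longrightarrow> f b \<in> N"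
  shows "p \<bind> f \<in> N"
  unfolding lin_def using assms by (intro fm.subspace_sum fm.subspace_scale) auto

text \<open>The preimage of a subspace is a subspace, so it contains the span as soon as it contains
  the spanning set.\<close>

lemma module_hom_lspan:
  assumes F: "module_hom scl scl F" and N: "fm.subspace N" and S: "\<And>s. s \<in> S \<Longrightarrow> F s \<in> N"
    and p: "p \<in> lspan S"
  shows "F p \<in> N"
proof -
  have "fm.subspace {p. F p \<in> N}" by (rule module_hom.subspace_linear_preimage[OF F N])
  then have "fm.span S \<subseteq> {p. F p \<in> N}" using S by (intro fm.span_minimal) auto
  with p show ?thesis by (auto simp: lspan_eq)
qed

section \<open>Tensor algebras and their two-sided ideals\<close>

lemma one_eq_bas: "(1 :: 'a list \<Rightarrow>\<^sub>0 'r::comm_ring_1) = bas []"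
  using single_one[where ?'a="'a list" and ?'b='r] by (simp only: zero_list_def)

lemma bas_Nil_mult [simp]:
  fixes p :: "'a list \<Rightarrow>\<^sub>0 'r::comm_ring_1"
  shows "bas [] * p = p" "p * bas [] = p"
  by (simp_all flip: one_eq_bas)

lemma bas_mult [simp]: "bas v * bas w = (bas (v @ w) :: 'a list \<Rightarrow>\<^sub>0 'r::comm_ring_1)"
  by (simp add: mult_single plus_list_def)

lemma scl_eq_mult: "scl c p = Poly_Mapping.single [] c * (p :: 'a list \<Rightarrow>\<^sub>0 'r::comm_ring_1)"
  by (simp add: scl_def mult_map_scale_conv_mult zero_list_def)

lemma mult_scl_left [simp]: "scl c p * p' = scl c (p * (p' :: 'a list \<Rightarrow>\<^sub>0 'r::comm_ring_1))"
  by (simp add: scl_eq_mult mult.assoc)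

lemma lin_mult_left: "(p \<bind> f) * p' = (p \<bind> (\<lambda>b. f b * (p' :: 'a list \<Rightarrow>\<^sub>0 'r::comm_ring_1)))"
  by (simp add: lin_def sum_distrib_right)

text \<open>Scalars are the multiples of the empty word. They commute with every word because the
  coefficient ring is commutative and the empty word is neutral for concatenation.\<close>

lemma bas_mult_scl: "bas v * scl c p = scl c (bas v * (p :: 'a list \<Rightarrow>\<^sub>0 'r::comm_ring_1))"
proof -
  have "bas v * Poly_Mapping.single [] c = Poly_Mapping.single [] c * (bas v :: 'a list \<Rightarrow>\<^sub>0 'r)"
    by (simp add: mult_single plus_list_def)
  then show ?thesis by (simp add: scl_eq_mult flip: mult.assoc)
qed

lemma mult_scl_right [simp]: "p * scl c p' = scl c (p * (p' :: 'a list \<Rightarrow>\<^sub>0 'r::comm_ring_1))"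
proof -
  have "p * scl c p' = (p \<bind> (\<lambda>b. bas b * scl c p'))" by (simp flip: lin_mult_left)
  also have "\<dots> = scl c (p \<bind> (\<lambda>b. bas b * p'))" by (simp add: bas_mult_scl lin_scl_right)
  finally show ?thesis by (simp flip: lin_mult_left)
qed

lemma lin_mult_right: "p * (p' \<bind> f) = (p' \<bind> (\<lambda>b. (p :: 'a list \<Rightarrow>\<^sub>0 'r::comm_ring_1) * f b))"
  by (simp add: lin_def sum_distrib_left)

lemma mult_eq_lin: "p * p' = (p \<bind> (\<lambda>v. p' \<bind> (\<lambda>w. bas (v @ w :: 'a list))))"
proof -
  have "p * p' = (p \<bind> (\<lambda>v. bas v)) * (p' \<bind> (\<lambda>v. bas v))" by simp
  then show ?thesis unfolding lin_mult_left unfolding lin_mult_right unfolding bas_mult .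
qed

lemma module_hom_mult: "module_hom scl scl (\<lambda>p. a * p * (b :: 'a list \<Rightarrow>\<^sub>0 'r::comm_ring_1))"
  by unfold_locales (auto simp: algebra_simps)

lemma subspace_lspan [simp]: "fm.subspace (lspan S)"
  by (simp add: lspan_eq)

lemma lspan_base: "s \<in> S \<Longrightarrow> s \<in> lspan S"
  by (simp add: lspan_eq fm.span_base)

lemma subspace_ideal_gen [simp]: "fm.subspace (ideal_gen S)"
  by (simp add: ideal_gen_def)

lemma ideal_gen_mult:
  assumes "p \<in> ideal_gen S"
  shows "a * p * b \<in> ideal_gen S"
  using module_hom_mult subspace_ideal_gen _ assms[unfolded ideal_gen_def]
proof (rule module_hom_lspan)
  fix s assume "s \<in> {p * s * p' |p s p'. s \<in> S}"
  then obtain c t d where "s = c * t * d" "t \<in> S" by auto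
  then have "a * s * b = (a * c) * t * (d * b)" by (simp add: mult.assoc)
  with \<open>t \<in> S\<close> show "a * s * b \<in> ideal_gen S"
    unfolding ideal_gen_def by (blast intro: lspan_base)
qed

lemma ideal_gen_mult_left: "p \<in> ideal_gen S \<Longrightarrow> a * p \<in> ideal_gen S"
  using ideal_gen_mult[of p S a 1] by simp

lemma ideal_gen_mult_right: "p \<in> ideal_gen S \<Longrightarrow> p * b \<in> ideal_gen S"
  using ideal_gen_mult[of p S 1 b] by simp

lemma ideal_gen_base: "s \<in> S \<Longrightarrow> s \<in> ideal_gen S"
  unfolding ideal_gen_def by (rule lspan_base) (force intro: exI[of _ 1])

text \<open>Expanding both cofactors of \<open>a * s * b\<close> into words leaves only word
  multiples of the relations to be checked.\<close>

lemma module_hom_ideal_gen: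
  assumes F: "module_hom scl scl F" and N: "fm.subspace N"
    and S: "\<And>u s v. s \<in> S \<Longrightarrow> F (bas u * s * bas v) \<in> N"
    and p: "p \<in> ideal_gen S"
  shows "F p \<in> N"
  using F N _ p[unfolded ideal_gen_def]
proof (rule module_hom_lspan)
  fix t assume "t \<in> {p * s * p' |p s p'. s \<in> S}"
  then obtain a s b where t: "t = a * s * b" and s: "s \<in> S" by auto
  have "a * s * b = (a \<bind> (\<lambda>u. bas u)) * s * (b \<bind> (\<lambda>v. bas v))" by simp
  then have "t = (b \<bind> (\<lambda>v. a \<bind> (\<lambda>u. bas u * s * bas v)))"
    unfolding t lin_mult_left lin_mult_right .
  then have "F t = (b \<bind> (\<lambda>v. a \<bind> (\<lambda>u. F (bas u * s * bas v))))"
    by (simp add: module_hom_lin_comm[OF F])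
  then show "F t \<in> N"
    by (simp add: lin_mem_subspace N S s)
qed

lemma subspace_tens_rel [simp]: "fm.subspace (tens_rel N N')"
  by (simp add: tens_rel_def)

lemma tens_rel_left: "p \<in> N \<Longrightarrow> tens p p' \<in> tens_rel N N'"
  unfolding tens_rel_def by (rule lspan_base) auto

lemma tens_rel_right: "p' \<in> N' \<Longrightarrow> tens p p' \<in> tens_rel N N'"
  unfolding tens_rel_def by (rule lspan_base) auto

text \<open>Bilinearity of \<open>tens\<close> allows the factor that carries no relation to be a
  basis word.\<close>

lemma module_hom_tens_rel:
  assumes F: "module_hom scl scl F" and M: "fm.subspace M"
    and l: "\<And>p b. p \<in> N \<Longrightarrow> F (tens p (bas b)) \<in> M"
    and r: "\<And>a p'. p' \<in> N' \<Longrightarrow> F (tens (bas a) p') \<in> M"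
    and P: "P \<in> tens_rel N N'"
  shows "F P \<in> M"
  using F M _ P[unfolded tens_rel_def]
proof (rule module_hom_lspan)
  fix t assume "t \<in> {tens p p' |p p'. p \<in> N} \<union> {tens p p' |p p'. p' \<in> N'}"
  then consider p p' where "t = tens p p'" "p \<in> N" | p p' where "t = tens p p'" "p' \<in> N'"
    by auto
  then show "F t \<in> M"
  proof cases
    case 1
    then have "F t = (p' \<bind> (\<lambda>b. F (tens p (bas b))))"
      by (simp add: tens_eq_lin'[of p p'] module_hom_lin_comm[OF F])
    with 1 show ?thesis by (simp add: lin_mem_subspace M l)
  next
    case 2
    then have "F t = (p \<bind> (\<lambda>a. F (tens (bas a) p')))"
      by (simp add: tens_eq_lin[of p p'] module_hom_lin_comm[OF F])
    with 2 show ?thesis by (simp add: lin_mem_subspace M r)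
  qed
qed

section \<open>Bicharacters and the braided coproduct\<close>

lemma unit_inv_right:
  fixes u :: "'r::comm_ring_1"
  assumes "u dvd 1"
  shows "u * unit_inv u = 1"
proof -
  from assms obtain v where v: "u * v = 1" by (metis dvdE)
  have "unit_inv u = v" unfolding unit_inv_def
  proof (rule the_equality)
    show "u * v = 1" by (fact v)
    fix w assume "u * w = 1"
    then show "w = v" using v by (metis mult.assoc mult.commute mult_1)
  qed
  with v show ?thesis by simp
qed

lemma unit_inv_eqI:
  fixes u v :: "'r::comm_ring_1"
  assumes "u * v = 1"
  shows "unit_inv u = v"
proof -
  have "u * unit_inv u = 1" using assms by (intro unit_inv_right) (metis dvd_triv_left)
  then show ?thesis using assms by (metis mult.assoc mult.commute mult_1)
qed

text \<open>Writing an integer exponent as a difference of naturals removes the sign distinction in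
  \<open>unit_powi\<close>; the exponent laws below then become identities between ordinary
  powers.\<close>

lemma unit_powi_diff:
  fixes u v :: "'r::comm_ring_1"
  assumes "u * v = 1"
  shows "unit_powi u (int a - int b) = u ^ a * v ^ b"
proof (cases "b \<le> a")
  case True
  have "u ^ a * v ^ b = u ^ (a - b) * (u ^ b * v ^ b)"
    using True by (simp flip: power_add mult.assoc)
  also have "\<dots> = u ^ (a - b)"
    using assms by (simp flip: power_mult_distrib)
  finally show ?thesis using True by (simp add: unit_powi_def nat_diff_distrib flip: of_nat_diff)
next
  case False
  then have "u ^ a * v ^ b = (u ^ a * v ^ a) * v ^ (b - a)"
    by (simp add: mult.assoc flip: power_add)
  also have "\<dots> = v ^ (b - a)"
    using assms by (simp flip: power_mult_distrib)
  finally show ?thesis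
    using False by (simp add: unit_powi_def unit_inv_eqI[OF assms] nat_diff_distrib)
qed

lemma unit_powi_add:
  fixes u :: "'r::comm_ring_1"
  assumes "u dvd 1"
  shows "unit_powi u (k + l) = unit_powi u k * unit_powi u l"
proof -
  obtain v where v: "u * v = 1" using assms by (metis dvdE)
  obtain a b where k: "k = int a - int b" by (rule int_diff_cases)
  obtain c d where l: "l = int c - int d" by (rule int_diff_cases)
  have "k + l = int (a + c) - int (b + d)" by (simp add: k l)
  then show ?thesis unfolding k l
    by (simp only: unit_powi_diff[OF v] power_add ac_simps)
qed

lemma unit_powi_mult_base:
  fixes u u' :: "'r::comm_ring_1"
  assumes "u dvd 1" "u' dvd 1"
  shows "unit_powi (u * u') k = unit_powi u k * unit_powi u' k"
proof -
  obtain v where v: "u * v = 1" using assms by (metis dvdE)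
  obtain v' where v': "u' * v' = 1" using assms by (metis dvdE)
  have vv: "(u * u') * (v * v') = 1" using v v' by (metis mult.assoc mult.left_commute mult_1_right)
  obtain a b where k: "k = int a - int b" by (rule int_diff_cases)
  show ?thesis
    unfolding k unit_powi_diff[OF v] unit_powi_diff[OF v'] unit_powi_diff[OF vv] power_mult_distrib
    by (simp add: ac_simps)
qed

lemma unit_powi_0 [simp]: "unit_powi u 0 = 1"
  by (simp add: unit_powi_def)

lemma unit_powi_1 [simp]: "unit_powi u 1 = u"
  by (simp add: unit_powi_def)

lemma unit_powi_one [simp]: "unit_powi 1 k = 1"
  by (simp add: unit_powi_def unit_inv_eqI)

section \<open>Multidegrees of words\<close>

lemma deg_Nil [simp]: "deg \<delta> [] = 0"
  by (simp add: deg_def fun_eq_iff)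

lemma deg_Cons [simp]: "deg \<delta> (a # w) = \<delta> a + deg \<delta> w"
  by (simp add: deg_def fun_eq_iff)

lemma deg_append [simp]: "deg \<delta> (v @ w) = deg \<delta> v + deg \<delta> w"
  by (simp add: deg_def fun_eq_iff)

lemma deg_d_eq: "deg_d i = - deg_x i"
  by (simp add: deg_d_def deg_x_def fun_eq_iff)

text \<open>The total degree recovers the length; homogeneity of the pairing thereby forces paired
  words to have equal length.\<close>

lemma sum_deg_x: "(\<Sum>j\<in>UNIV. deg deg_x w j) = int (length (w :: 'n::finite list))"
proof (induction w)
  case (Cons a w)
  have "(\<Sum>j\<in>UNIV. deg_x a j) = 1" by (simp add: deg_x_def)
  then show ?case using Cons by (simp add: sum.distrib)
qed simp

lemma deg_deg_d: "deg deg_d w = - deg deg_x w"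
proof (induction w)
  case (Cons a w) then show ?case by (simp add: deg_d_eq fun_eq_iff)
qed (simp add: fun_eq_iff)

text \<open>On the diagonal only invertibility is asked. Whether \<open>q i i ^ 2 = 1\<close> is the
  question on which the final equivalence turns.\<close>

locale braiding =
  fixes q :: "'n::finite \<Rightarrow> 'n \<Rightarrow> 'r::comm_ring_1"
  assumes q_unit: "q i j dvd 1"
    and q_skew: "i \<noteq> j \<Longrightarrow> q j i = unit_inv (q i j)"
begin

abbreviation "\<chi> \<equiv> bichar q"

lemma bichar_add_left: "\<chi> (d + d') e = \<chi> d e * \<chi> d' e"
  unfolding bichar_def by (simp add: distrib_right unit_powi_add[OF q_unit] prod.distrib)

lemma bichar_add_right: "\<chi> d (e + e') = \<chi> d e * \<chi> d e'"
  unfolding bichar_def by (simp add: distrib_left unit_powi_add[OF q_unit] prod.distrib)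

lemma bichar_0_left [simp]: "\<chi> 0 e = 1"
  by (simp add: bichar_def)

lemma bichar_0_right [simp]: "\<chi> d 0 = 1"
  by (simp add: bichar_def)

lemma bichar_minus_left: "\<chi> (- d) e = unit_inv (\<chi> d e)"
  by (rule unit_inv_eqI[symmetric]) (simp flip: bichar_add_left)

lemma bichar_minus_right: "\<chi> d (- e) = unit_inv (\<chi> d e)"
  by (rule unit_inv_eqI[symmetric]) (simp flip: bichar_add_right)

lemma bichar_inv_right [simp]: "\<chi> d e * unit_inv (\<chi> d e) = 1"
  unfolding bichar_minus_left[symmetric] by (simp flip: bichar_add_left)

lemma bichar_inv_left [simp]: "unit_inv (\<chi> d e) * \<chi> d e = 1"
  by (simp add: mult.commute)

text \<open>Two sign changes cancel. This is why the \<partial> letters obey relations with the same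
  coefficients as the x letters, whereas the mixed coefficient is inverted.\<close>

lemma bichar_minus_minus: "\<chi> (- d) (- e) = \<chi> d e"
proof -
  have "unit_inv (unit_inv (\<chi> d e)) = \<chi> d e"
    by (rule unit_inv_eqI) simp
  then show ?thesis by (simp add: bichar_minus_left bichar_minus_right)
qed

lemma bichar_deg_x [simp]: "\<chi> (deg_x i) (deg_x j) = q i j"
proof -
  have *: "unit_powi (q a b) (deg_x i a * deg_x j b) = (if b = j then if a = i then q i j else 1 else 1)"
    for a b by (auto simp: deg_x_def)
  have "\<chi> (deg_x i) (deg_x j) = (\<Prod>a\<in>UNIV. if a = i then q i j else 1)"
    unfolding bichar_def * by (rule prod.cong) simp_all
  then show ?thesis by simp
qed

lemma bichar_deg_d [simp]: "\<chi> (deg_d i) (deg_d j) = q i j"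
  by (simp add: deg_d_eq bichar_minus_minus)

lemma bichar_deg_d_x [simp]: "\<chi> (deg_d i) (deg_x j) = unit_inv (q i j)"
  by (simp add: deg_d_eq bichar_minus_left)

lemma q_swap: "i \<noteq> j \<Longrightarrow> q i j * q j i = 1"
  using unit_inv_right[OF q_unit, of i j] q_skew[of i j] by simp

text \<open>In the product with \<open>a \<otimes> 1 + 1 \<otimes> a\<close> only the summand
  \<open>1 \<otimes> a\<close> has to cross the left factor \<open>c\<close>, which produces the
  single weight.\<close>

lemma comul_Cons:
  "comul q \<delta> (a # w) =
    (comul q \<delta> w \<bind> (\<lambda>(c, d). bas (a # c, d) + scl (\<chi> (\<delta> a) (deg \<delta> c)) (bas (c, a # d))))"
  by (simp add: braided_mul_def one_eq_bas mul_def braid_def lin_add_right split_def)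

lemma comul_Nil: "comul q \<delta> [] = bas ([], [])"
  by (simp add: one_eq_bas)

declare comul.simps [simp del]

lemma deg_comul:
  "(c, d) \<in> Poly_Mapping.keys (comul q \<delta> w) \<Longrightarrow> deg \<delta> c + deg \<delta> d = deg \<delta> w"
proof (induction w arbitrary: c d)
  case Nil then show ?case by (simp add: comul_Nil)
next
  case (Cons a w)
  from Cons.prems obtain c' d' where cd': "(c', d') \<in> Poly_Mapping.keys (comul q \<delta> w)"
    and "(c, d) \<in> Poly_Mapping.keys (bas (a # c', d') + scl (\<chi> (\<delta> a) (deg \<delta> c')) (bas (c', a # d')))"
    unfolding comul_Cons using keys_lin by fast
  then have "(c, d) = (a # c', d') \<or> (c, d) = (c', a # d')"
    using keys_add by (fastforce simp: in_keys_iff lookup_add lookup_single when_def split: if_splits)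
  with Cons.IH[OF cd'] show ?case by (auto simp flip: Cons.IH[OF cd'] simp: ac_simps)
qed

text \<open>
  With \<open>A i c = i # c\<close> and \<open>\<delta>' = \<delta>\<close> this is the recursion step of \<open>\<Delta>\<close>; with \<open>A i\<close> the action of \<open>\<partial>\<^sub>i\<close>
  it is left multiplication by \<open>1 \<otimes> \<partial>\<^sub>i\<close> in the double. The commutator formula below serves both.
\<close>

definition skew_step ::
    "('n \<Rightarrow> 'n \<Rightarrow> int) \<Rightarrow> ('n \<Rightarrow> 'n \<Rightarrow> int) \<Rightarrow> ('n \<Rightarrow> 'n list \<Rightarrow> ('n list \<Rightarrow>\<^sub>0 'r)) \<Rightarrow>
     'n \<Rightarrow> 'n list \<times> 'n list \<Rightarrow> ('n list \<times> 'n list \<Rightarrow>\<^sub>0 'r)" where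
  "skew_step \<delta> \<delta>' A i = (\<lambda>(c, d).
     tens (A i c) (bas d) + scl (\<chi> (\<delta> i) (deg \<delta>' c)) (bas (c, i # d)))"

lemma comul_Cons_step: "comul q \<delta> (a # w) = (comul q \<delta> w \<bind> skew_step \<delta> \<delta> (\<lambda>i c. bas (i # c)) a)"
  by (simp add: comul_Cons skew_step_def)

lemma tens_skew_step:
  "tens p (bas d) \<bind> skew_step \<delta> \<delta>' A i =
    tens (p \<bind> A i) (bas d) + tens (p \<bind> (\<lambda>c. scl (\<chi> (\<delta> i) (deg \<delta>' c)) (bas c))) (bas (i # d))"
  by (simp add: tens_lin skew_step_def lin_add_right tens_lin_left)

text \<open>The assumption says that \<open>A j\<close> shifts degrees by \<open>\<delta> j\<close>.
  The weight of the second step is therefore constant on the support of \<open>A j c\<close> and can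
  be pulled out of the sum.\<close>

lemma skew_step_twice:
  assumes "\<And>k. k \<in> Poly_Mapping.keys (A j c) \<Longrightarrow> deg \<delta>' k = \<delta> j + deg \<delta>' c"
  shows "skew_step \<delta> \<delta>' A j (c, d) \<bind> skew_step \<delta> \<delta>' A i =
    tens (A j c \<bind> A i) (bas d) +
    scl (\<chi> (\<delta> i) (\<delta> j) * \<chi> (\<delta> i) (deg \<delta>' c)) (tens (A j c) (bas (i # d))) +
    scl (\<chi> (\<delta> j) (deg \<delta>' c)) (tens (A i c) (bas (j # d))) +
    scl (\<chi> (\<delta> j) (deg \<delta>' c) * \<chi> (\<delta> i) (deg \<delta>' c)) (bas (c, i # j # d))"
proof -
  have "(A j c \<bind> (\<lambda>k. scl (\<chi> (\<delta> i) (deg \<delta>' k)) (bas k))) =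
      (A j c \<bind> (\<lambda>k. scl (\<chi> (\<delta> i) (\<delta> j) * \<chi> (\<delta> i) (deg \<delta>' c)) (bas k)))"
    by (rule lin_cong) (simp add: assms bichar_add_right)
  also have "\<dots> = scl (\<chi> (\<delta> i) (\<delta> j) * \<chi> (\<delta> i) (deg \<delta>' c)) (A j c)"
    by (simp add: lin_scl_right)
  finally show ?thesis
    by (simp add: skew_step_def[of _ _ _ j] tens_skew_step) (simp add: skew_step_def add_ac)
qed

text \<open>Of the four terms of each composite the two mixed ones cancel: one pair has equal
  coefficients by bimultiplicativity, the other because \<open>q i j * q j i = 1\<close>. Only a
  commutator in each tensor factor remains.\<close>

lemma skew_step_commutator:
  assumes A: "\<And>i c k. k \<in> Poly_Mapping.keys (A i c) \<Longrightarrow> deg \<delta>' k = \<delta> i + deg \<delta>' c"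
    and q: "\<chi> (\<delta> i) (\<delta> j) = q i j" "\<chi> (\<delta> j) (\<delta> i) = q j i" and ij: "i \<noteq> j"
  shows "(skew_step \<delta> \<delta>' A j (c, d) \<bind> skew_step \<delta> \<delta>' A i) -
      scl (q i j) (skew_step \<delta> \<delta>' A i (c, d) \<bind> skew_step \<delta> \<delta>' A j) =
    tens ((A j c \<bind> A i) - scl (q i j) (A i c \<bind> A j)) (bas d) +
    scl (\<chi> (\<delta> i) (deg \<delta>' c) * \<chi> (\<delta> j) (deg \<delta>' c))
      (tens (bas c) ((bas [i, j] - scl (q i j) (bas [j, i])) * bas d))"
proof -
  have *: "q i j * (q j i * x) = x" for x
    using q_swap[OF ij] by (simp flip: mult.assoc)
  show ?thesis
    by (simp add: skew_step_twice A q * left_diff_distrib) (simp add: algebra_simps)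
qed

section \<open>The defining relations and the coproduct on the quotient\<close>

abbreviation "sq_rel i j \<equiv> bas [i, j] - scl (q i j) (bas [j, i])"

lemma sq_ideal_eq:
  assumes "\<delta> \<in> {deg_x, deg_d}"
  shows "sq_ideal q \<delta> = ideal_gen {sq_rel i j | i j. i \<noteq> j}"
  using assms by (auto simp: sq_ideal_def mul_def braid_def)

lemma sq_rel_mem:
  assumes "\<delta> \<in> {deg_x, deg_d}" "i \<noteq> j"
  shows "sq_rel i j \<in> sq_ideal q \<delta>"
  unfolding sq_ideal_eq[OF assms(1)] using assms(2) by (blast intro: ideal_gen_base)

lemma subspace_sq_ideal [simp]: "fm.subspace (sq_ideal q \<delta>)"
  by (simp add: sq_ideal_def)

lemma sq_ideal_mult: "p \<in> sq_ideal q \<delta> \<Longrightarrow> a * p * b \<in> sq_ideal q \<delta>"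
  unfolding sq_ideal_def by (rule ideal_gen_mult)

lemma sq_ideal_mult_left: "p \<in> sq_ideal q \<delta> \<Longrightarrow> a * p \<in> sq_ideal q \<delta>"
  unfolding sq_ideal_def by (rule ideal_gen_mult_left)

lemma sq_ideal_mult_right: "p \<in> sq_ideal q \<delta> \<Longrightarrow> p * b \<in> sq_ideal q \<delta>"
  unfolding sq_ideal_def by (rule ideal_gen_mult_right)

text \<open>Both words of \<open>sq_rel i j\<close> have the same degree, so a weight depending on
  the degree multiplies each word multiple of a relation by one constant.\<close>

lemma sq_ideal_graded:
  assumes \<delta>: "\<delta> \<in> {deg_x, deg_d}" and "p \<in> sq_ideal q \<delta>"
  shows "p \<bind> (\<lambda>w. scl (m (deg \<delta> w)) (bas w)) \<in> sq_ideal q \<delta>"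
  using module_hom_lin subspace_sq_ideal _ assms(2)[unfolded sq_ideal_eq[OF \<delta>]]
proof (rule module_hom_ideal_gen)
  fix u s v assume "s \<in> {sq_rel i j | i j. i \<noteq> j}"
  then obtain i j where s: "s = sq_rel i j" and ij: "i \<noteq> j" by auto
  have "bas u * s * bas v \<bind> (\<lambda>w. scl (m (deg \<delta> w)) (bas w)) =
      scl (m (deg \<delta> (u @ [i, j] @ v))) (bas u * s * bas v)"
    by (simp add: s algebra_simps)
  also have "\<dots> \<in> sq_ideal q \<delta>"
    by (intro fm.subspace_scale subspace_sq_ideal sq_ideal_mult) (simp add: s sq_rel_mem[OF \<delta> ij])
  finally show "bas u * s * bas v \<bind> (\<lambda>w. scl (m (deg \<delta> w)) (bas w)) \<in> sq_ideal q \<delta>" .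
qed

text \<open>Diagonal braiding weights may hence be ignored when a linear map is checked on the
  ideal.\<close>

lemma sq_ideal_lin:
  assumes "\<delta> \<in> {deg_x, deg_d}" "p \<in> sq_ideal q \<delta>"
    and "\<And>p. p \<in> sq_ideal q \<delta> \<Longrightarrow> p \<bind> F \<in> N"
  shows "p \<bind> (\<lambda>w. scl (m (deg \<delta> w)) (F w)) \<in> N"
  using assms(3)[OF sq_ideal_graded[OF assms(1,2)], of m] by (simp add: lin_assoc)

text \<open>The coproduct descends to the quotient: on a relation followed by a word,
  \<open>skew_step_commutator\<close> yields a relation in the left factor plus one in the right
  factor.\<close>

lemma comul_sq_ideal:
  assumes \<delta>: "\<delta> \<in> {deg_x, deg_d}" and p: "p \<in> sq_ideal q \<delta>"
  shows "p \<bind> comul q \<delta> \<in> tens_rel (sq_ideal q \<delta>) (sq_ideal q \<delta>)"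
    (is "_ \<in> ?N")
  using module_hom_lin subspace_tens_rel _ p[unfolded sq_ideal_eq[OF \<delta>]]
proof (rule module_hom_ideal_gen)
  fix u s v assume "s \<in> {sq_rel i j | i j. i \<noteq> j}"
  then obtain i j where s: "s = sq_rel i j" and ij: "i \<noteq> j" by auto
  have q: "\<chi> (\<delta> i) (\<delta> j) = q i j" for i j using \<delta> by auto
  let ?step = "skew_step \<delta> \<delta> (\<lambda>i c. bas (i # c))"
  \<comment> \<open>Prepending a letter preserves the relations, since multiplication by
    \<open>a\<close> stays in the ideal and the crossing weight depends only on a degree. This
    handles the prefix \<open>u\<close> in the induction below.\<close>
  have step: "P \<bind> ?step a \<in> ?N" if "P \<in> ?N" for P a
    using module_hom_lin subspace_tens_rel _ _ that
  proof (rule module_hom_tens_rel)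
    fix p b assume "p \<in> sq_ideal q \<delta>"
    moreover have "p \<bind> (\<lambda>c. bas (a # c)) = bas [a] * p" by (simp add: mult_eq_lin)
    ultimately show "tens p (bas b) \<bind> ?step a \<in> ?N"
      unfolding tens_skew_step
      by (auto intro!: fm.subspace_add tens_rel_left sq_ideal_mult_left sq_ideal_graded[OF \<delta>])
  next
    fix c p' assume p': "p' \<in> sq_ideal q \<delta>"
    have "tens (bas c) p' \<bind> ?step a =
        tens (bas (a # c)) p' + scl (\<chi> (\<delta> a) (deg \<delta> c)) (tens (bas c) (bas [a] * p'))"
      by (simp add: tens_lin skew_step_def lin_add_right lin_scl_right mult_eq_lin tens_lin_right
          tens_bas_left lin_assoc)
    also have "\<dots> \<in> ?N"
      by (intro fm.subspace_add subspace_tens_rel fm.subspace_scale tens_rel_right p' sq_ideal_mult_left)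
    finally show "tens (bas c) p' \<bind> ?step a \<in> ?N" .
  qed
  have comul_step: "bas [a] * p \<bind> comul q \<delta> = (p \<bind> comul q \<delta> \<bind> ?step a)" for a p
    by (simp add: mult_eq_lin lin_assoc comul_Cons_step)
  show "bas u * s * bas v \<bind> comul q \<delta> \<in> ?N"
  proof (induction u)
    case Nil
    have "bas [] * s * bas v = bas (i # j # v) - scl (q i j) (bas (j # i # v))"
      by (simp add: s left_diff_distrib right_diff_distrib)
    then have "bas [] * s * bas v \<bind> comul q \<delta> =
        (comul q \<delta> v \<bind> (\<lambda>cd. (?step j cd \<bind> ?step i) - scl (q i j) (?step i cd \<bind> ?step j)))"
      by (simp add: comul_Cons_step lin_assoc lin_diff_right lin_scl_right)
    also have "\<dots> \<in> ?N"
    proof (rule lin_mem_subspace[OF subspace_tens_rel])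
      fix cd :: "'n list \<times> 'n list"
      obtain c d where cd: "cd = (c, d)" by (cases cd)
      have r: "sq_rel i j * p \<in> sq_ideal q \<delta>" for p
        by (rule sq_ideal_mult_right) (rule sq_rel_mem[OF \<delta> ij])
      have "(?step j (c, d) \<bind> ?step i) - scl (q i j) (?step i (c, d) \<bind> ?step j) =
          tens (sq_rel i j * bas c) (bas d) +
          scl (\<chi> (\<delta> i) (deg \<delta> c) * \<chi> (\<delta> j) (deg \<delta> c)) (tens (bas c) (sq_rel i j * bas d))"
        using ij by (subst skew_step_commutator) (simp_all add: q left_diff_distrib)
      also have "\<dots> \<in> ?N"
        by (intro fm.subspace_add subspace_tens_rel fm.subspace_scale tens_rel_right tens_rel_left r)
      finally show "(?step j cd \<bind> ?step i) - scl (q i j) (?step i cd \<bind> ?step j) \<in> ?N"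
        by (simp add: cd)
    qed
    finally show ?case .
  next
    case (Cons a u)
    have "bas (a # u) * s * bas v = bas [a] * (bas u * s * bas v)"
      by (simp flip: mult.assoc)
    then show ?case using step[OF Cons] by (simp only: comul_step)
  qed
qed

end

section \<open>Quotient algebras\<close>

text \<open>The conditions under which \<open>\<mu>\<close> descends to the quotient, so that the
  unions of cosets in \<open>quot_alg\<close> are single cosets.\<close>

definition bilinear_compat ::
    "('b \<Rightarrow>\<^sub>0 'r::comm_ring_1) set \<Rightarrow> (('b \<Rightarrow>\<^sub>0 'r) \<Rightarrow> ('b \<Rightarrow>\<^sub>0 'r) \<Rightarrow> ('b \<Rightarrow>\<^sub>0 'r)) \<Rightarrow> bool" where
  "bilinear_compat N \<mu> \<longleftrightarrow> fm.subspace N \<and>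
    (\<forall>p. module_hom scl scl (\<mu> p)) \<and> (\<forall>p'. module_hom scl scl (\<lambda>p. \<mu> p p')) \<and>
    (\<forall>p p'. p \<in> N \<longrightarrow> \<mu> p p' \<in> N) \<and> (\<forall>p p'. p' \<in> N \<longrightarrow> \<mu> p p' \<in> N)"

lemma cls_eq_iff:
  assumes "fm.subspace N"
  shows "cls N p = cls N p' \<longleftrightarrow> p - p' \<in> N"
proof
  assume "cls N p = cls N p'"
  moreover have "p \<in> cls N p" using assms by (simp add: cls_def fm.subspace_0)
  ultimately show "p - p' \<in> N" by (simp add: cls_def)
next
  assume *: "p - p' \<in> N"
  have "p'' - p \<in> N \<longleftrightarrow> p'' - p' \<in> N" for p''
  proof -
    have "p'' - p' = (p'' - p) + (p - p')" "p'' - p = (p'' - p') - (p - p')" by simp_all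
    with * assms show ?thesis by (metis fm.subspace_add fm.subspace_diff)
  qed
  then show "cls N p = cls N p'" by (simp add: cls_def)
qed

lemma self_mem_cls: "fm.subspace N \<Longrightarrow> p \<in> cls N p"
  by (simp add: cls_def fm.subspace_0)

lemma Union_cls:
  assumes "fm.subspace N" "\<And>p'. p' - p \<in> N \<Longrightarrow> f p' - f p \<in> N"
  shows "(\<Union>p'\<in>cls N p. cls N (f p')) = cls N (f p)"
proof (rule SUP_eq_const)
  show "cls N p \<noteq> {}" using self_mem_cls[OF assms(1)] by blast
next
  fix p' assume "p' \<in> cls N p"
  then have "f p' - f p \<in> N" by (intro assms(2)) (simp add: cls_def)
  then show "cls N (f p') = cls N (f p)" by (simp add: cls_eq_iff[OF assms(1)])
qed

lemma Union_cls2: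
  assumes N: "fm.subspace N"
    and l: "\<And>p1 p2 p'. p1 - p2 \<in> N \<Longrightarrow> f p1 p' - f p2 p' \<in> N"
    and r: "\<And>p p1' p2'. p1' - p2' \<in> N \<Longrightarrow> f p p1' - f p p2' \<in> N"
  shows "(\<Union>r\<in>cls N p. \<Union>r'\<in>cls N p'. cls N (f r r')) = cls N (f p p')"
proof -
  have "(\<Union>r'\<in>cls N p'. cls N (f r r')) = cls N (f r p')" for r
    by (rule Union_cls[OF N]) (rule r)
  moreover have "(\<Union>r\<in>cls N p. cls N (f r p')) = cls N (f p p')"
    by (rule Union_cls[OF N]) (rule l)
  ultimately show ?thesis by simp
qed

lemma quot_alg_simps:
  assumes N: "fm.subspace N"
  shows "cls N p \<oplus>\<^bsub>quot_alg N \<mu> u\<^esub> cls N p' = cls N (p + p')"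
    and "c \<odot>\<^bsub>quot_alg N \<mu> u\<^esub> cls N p = cls N (scl c p)"
    and "\<one>\<^bsub>quot_alg N \<mu> u\<^esub> = cls N u" "\<zero>\<^bsub>quot_alg N \<mu> u\<^esub> = cls N 0"
proof -
  show "cls N p \<oplus>\<^bsub>quot_alg N \<mu> u\<^esub> cls N p' = cls N (p + p')"
    using Union_cls2[OF N, where f = "(+)"] by (simp add: quot_alg_def)
  have "scl c p' - scl c p \<in> N" if "p' - p \<in> N" for p'
    using fm.subspace_scale[OF N that, of c] by simp
  then show "c \<odot>\<^bsub>quot_alg N \<mu> u\<^esub> cls N p = cls N (scl c p)"
    using Union_cls[OF N, where f = "scl c"] by (simp add: quot_alg_def)
qed (simp_all add: quot_alg_def)

lemma quot_alg_mult:
  assumes "bilinear_compat N \<mu>"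
  shows "cls N p \<otimes>\<^bsub>quot_alg N \<mu> u\<^esub> cls N p' = cls N (\<mu> p p')"
proof -
  from assms have N: "fm.subspace N" and r: "\<And>p p'. p' \<in> N \<Longrightarrow> \<mu> p p' \<in> N"
    and hr: "\<And>p. module_hom scl scl (\<mu> p)" and hl: "\<And>p'. module_hom scl scl (\<lambda>p. \<mu> p p')"
    and l: "\<And>p p'. p \<in> N \<Longrightarrow> \<mu> p p' \<in> N"
    unfolding bilinear_compat_def by auto
  show ?thesis
    unfolding quot_alg_def using Union_cls2[OF N, where f = \<mu>] l r
    by (simp flip: module_hom.diff[OF hl] module_hom.diff[OF hr])
qed

lemma quot_alg_carrier: "carrier (quot_alg N \<mu> u) = range (cls N)"
  by (auto simp: quot_alg_def)

text \<open>The first isomorphism theorem, stated for a map between the free modules so that no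
  quotient map has to be constructed by hand.\<close>

lemma quot_alg_iso:
  fixes \<Phi> :: "('b \<Rightarrow>\<^sub>0 'r::comm_ring_1) \<Rightarrow> ('c \<Rightarrow>\<^sub>0 'r)"
  assumes N: "bilinear_compat N \<mu>" and M: "bilinear_compat M \<nu>"
    and \<Phi>: "module_hom scl scl \<Phi>"
    and mult: "\<And>p p'. \<Phi> (\<mu> p p') = \<nu> (\<Phi> p) (\<Phi> p')" and unit: "\<Phi> u = v"
    and ker: "\<And>p. \<Phi> p \<in> M \<longleftrightarrow> p \<in> N" and sur: "surj \<Phi>"
  shows "\<exists>\<Psi> \<in> ring_iso (quot_alg N \<mu> u) (quot_alg M \<nu> v).
    (\<forall>c. \<forall>a \<in> carrier (quot_alg N \<mu> u).
       \<Psi> (c \<odot>\<^bsub>quot_alg N \<mu> u\<^esub> a) = c \<odot>\<^bsub>quot_alg M \<nu> v\<^esub> \<Psi> a) \<and>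
    (\<forall>p. \<Psi> (cls N p) = cls M (\<Phi> p))"
proof -
  have sN: "fm.subspace N" and sM: "fm.subspace M"
    using N M by (simp_all add: bilinear_compat_def)
  \<comment> \<open>An arbitrary representative is chosen; the result is independent of it because
    \<open>\<Phi>\<close> maps \<open>N\<close> into \<open>M\<close>.\<close>
  define \<Psi> where "\<Psi> C = cls M (\<Phi> (SOME p. p \<in> C))" for C
  have \<Psi>: "\<Psi> (cls N p) = cls M (\<Phi> p)" for p
  proof -
    have "(SOME p'. p' \<in> cls N p) \<in> cls N p"
      by (rule someI[of _ p]) (rule self_mem_cls[OF sN])
    then show ?thesis
      by (simp add: \<Psi>_def cls_eq_iff[OF sM] ker flip: module_hom.diff[OF \<Phi>]) (simp add: cls_def)
  qed
  have "\<Psi> \<in> ring_hom (quot_alg N \<mu> u) (quot_alg M \<nu> v)"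
    by (rule ring_hom_memI)
      (auto simp: quot_alg_carrier \<Psi> quot_alg_mult[OF N] quot_alg_mult[OF M] quot_alg_simps[OF sN]
        quot_alg_simps[OF sM] mult unit module_hom.add[OF \<Phi>])
  moreover have "bij_betw \<Psi> (range (cls N)) (range (cls M))"
  proof (rule bij_betwI')
    fix C D assume "C \<in> range (cls N)" "D \<in> range (cls N)"
    then obtain p p' where "C = cls N p" "D = cls N p'" by blast
    then show "(\<Psi> C = \<Psi> D) = (C = D)"
      by (simp add: \<Psi> cls_eq_iff[OF sM] cls_eq_iff[OF sN] ker flip: module_hom.diff[OF \<Phi>])
  next
    fix D assume "D \<in> range (cls M)"
    then obtain P where "D = cls M P" by auto
    moreover obtain p where "P = \<Phi> p" using sur by (metis surjD)
    ultimately have "D = \<Psi> (cls N p)" by (simp add: \<Psi>)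
    then show "\<exists>C\<in>range (cls N). D = \<Psi> C" by blast
  qed (auto simp: \<Psi>)
  ultimately have "\<Psi> \<in> ring_iso (quot_alg N \<mu> u) (quot_alg M \<nu> v)"
    by (simp add: ring_iso_def quot_alg_carrier)
  moreover have "\<Psi> (c \<odot>\<^bsub>quot_alg N \<mu> u\<^esub> a) = c \<odot>\<^bsub>quot_alg M \<nu> v\<^esub> \<Psi> a"
    if "a \<in> carrier (quot_alg N \<mu> u)" for c a
    using that by (auto simp: quot_alg_carrier \<Psi> quot_alg_simps[OF sN] quot_alg_simps[OF sM]
        module_hom.scale[OF \<Phi>])
  ultimately show ?thesis using \<Psi> by blast
qed

lemma counit_eq: "counit w = (if w = [] then 1 else 0)"
  by (cases w) auto

section \<open>The product of the Heisenberg double\<close>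

text \<open>
  Well-definedness on the quotient needs no property of the weight \<open>b\<close>: the braiding and its
  inverse are both diagonal, and the relations are homogeneous.
\<close>

definition heis_braiding :: "(('n \<Rightarrow> int) \<Rightarrow> ('n \<Rightarrow> int) \<Rightarrow> 'r::comm_ring_1) \<Rightarrow>
    'n list \<times> 'n list \<Rightarrow> ('n list \<times> 'n list \<Rightarrow>\<^sub>0 'r)" where
  "heis_braiding b = (\<lambda>(v, w). scl (b (deg deg_x v) (deg deg_x w)) (bas (w, v)))"

lemma braid_eq: "braid q deg_x deg_x = heis_braiding (bichar q)"
  by (simp add: braid_def heis_braiding_def)

lemma braid_inv_eq: "braid_inv q deg_x deg_x = heis_braiding (\<lambda>d d'. unit_inv (bichar q d' d))"
  by (simp add: braid_inv_def heis_braiding_def)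

text \<open>In the double this is left multiplication by \<open>p \<otimes> 1\<close>.\<close>

definition lmul :: "('a list \<Rightarrow>\<^sub>0 'r::comm_ring_1) \<Rightarrow> ('a list \<times> 'b \<Rightarrow>\<^sub>0 'r) \<Rightarrow> ('a list \<times> 'b \<Rightarrow>\<^sub>0 'r)" where
  "lmul p P = P \<bind> (\<lambda>(k, g). tens (p * bas k) (bas g))"

lemma lmul_linear [simp]:
  "lmul (p + p') P = lmul p P + lmul p' P" "lmul p (P + P') = lmul p P + lmul p P'"
  "lmul (scl c p) P = scl c (lmul p P)" "lmul p (scl c P) = scl c (lmul p P)"
  by (simp_all add: lmul_def split_def distrib_right lin_add_right lin_scl_right)

lemma lmul_diff_left [simp]: "lmul (p - p') P = lmul p P - lmul p' P"
  using lmul_linear(1)[of "p - p'" p' P] by simp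

lemma lmul_lin_right: "lmul p (P \<bind> F) = (P \<bind> (\<lambda>b. lmul p (F b)))"
  by (simp add: lmul_def lin_assoc)

lemma lmul_lin_left: "lmul (p \<bind> f) P = (p \<bind> (\<lambda>b. lmul (f b) P))"
proof -
  have "lmul (p \<bind> f) P = (P \<bind> (\<lambda>kg. p \<bind> (\<lambda>b. tens (f b * bas (fst kg)) (bas (snd kg)))))"
    by (simp add: lmul_def split_def lin_mult_left tens_lin_left)
  also have "\<dots> = (p \<bind> (\<lambda>b. lmul (f b) P))"
    unfolding lmul_def split_def by (rule lin_commute)
  finally show ?thesis .
qed

lemma lmul_tens: "lmul p (tens p' p'') = tens (p * p') p''"
proof -
  have "lmul p (tens p' p'') = (p' \<bind> (\<lambda>a. tens (p * bas a) p''))"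
    by (simp add: lmul_def tens_lin flip: tens_eq_lin')
  also have "\<dots> = tens (p * (p' \<bind> (\<lambda>a. bas a))) p''"
    unfolding lin_mult_right tens_lin_left ..
  finally show ?thesis by simp
qed

lemma lmul_bas [simp]: "lmul (bas h) (bas (k, g)) = bas (h @ k, g)"
  by (simp add: lmul_def)

lemma lin_append_tens: "p \<bind> (\<lambda>k. bas (h @ k, w)) = tens (bas h * p) (bas w)"
  by (simp add: mult_eq_lin tens_lin_left)

lemma lmul_lmul: "lmul p (lmul p' P) = lmul (p * p') P"
proof -
  have "lmul p (lmul p' P) = (P \<bind> (\<lambda>kg. lmul p (tens (p' * bas (fst kg)) (bas (snd kg)))))"
    by (simp add: lmul_def[of p'] lmul_lin_right split_def)
  also have "\<dots> = lmul (p * p') P"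
    by (simp add: lmul_tens) (simp add: lmul_def split_def mult.assoc)
  finally show ?thesis .
qed

lemma lmul_one [simp]: "lmul (bas []) P = P"
  by (simp add: lmul_def split_def)

section \<open>The Hopf pairing on words and well-definedness of the double\<close>

locale hopf_paired = braiding q
  for q :: "'n::finite \<Rightarrow> 'n \<Rightarrow> 'r::comm_ring_1" +
  fixes pr :: "'n list \<Rightarrow> 'n list \<Rightarrow> 'r"
  assumes pairing: "hopf_pairing q pr"
begin

lemma pr_nonzero_deg:
  assumes "pr f h \<noteq> 0"
  shows "deg deg_x h = - deg deg_d f"
proof -
  have "\<forall>f h. (\<exists>j. deg deg_d f j + deg deg_x h j \<noteq> 0) \<longrightarrow> pr f h = 0"
    using pairing unfolding hopf_pairing_def by (elim conjE)
  with assms have "deg deg_d f j + deg deg_x h j = 0" for j by blast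
  then show ?thesis by (simp add: fun_eq_iff eq_neg_iff_add_eq_0 add.commute)
qed

lemma pr_single: "pr [i] [j] = (if i = j then 1 else 0)"
proof -
  have "\<forall>i j. pr [i] [j] = (if i = j then 1 else 0)"
    using pairing unfolding hopf_pairing_def by (elim conjE)
  then show ?thesis by blast
qed

lemma pr_Nil_left: "pr [] h = (if h = [] then 1 else 0)"
proof -
  have "\<forall>h. pr [] h = counit h"
    using pairing unfolding hopf_pairing_def by (elim conjE)
  then show ?thesis by (simp add: counit_eq)
qed

lemma pr_Nil_right: "pr f [] = (if f = [] then 1 else 0)"
proof -
  have "\<forall>f. pr f [] = counit f"
    using pairing unfolding hopf_pairing_def by (elim conjE)
  then show ?thesis by (simp add: counit_eq)
qed

lemma pr_sq_left:
  assumes "F \<in> sq_ideal q deg_d"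
  shows "lin_form F (\<lambda>f. pr f h) = 0"
proof -
  have "\<forall>F G. F \<in> sq_ideal q deg_d \<longrightarrow> pair_ext pr F G = 0"
    using pairing unfolding hopf_pairing_def by (elim conjE)
  with assms have "pair_ext pr F (bas h) = 0" by blast
  then show ?thesis by (simp add: pair_ext_def tens_def lin_form_lin)
qed

lemma pr_sq_right:
  assumes "G \<in> sq_ideal q deg_x"
  shows "lin_form G (pr f) = 0"
proof -
  have "\<forall>F G. G \<in> sq_ideal q deg_x \<longrightarrow> pair_ext pr F G = 0"
    using pairing unfolding hopf_pairing_def by (elim conjE)
  with assms have "pair_ext pr (bas f) G = 0" by blast
  then show ?thesis by (simp add: pair_ext_def tens_bas_left lin_form_lin)
qed

text \<open>Multiplicativity of the pairing in \<open>H\<close>, read for a product whose first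
  factor is one letter; it drives the recursion of the action on words in the x letters.\<close>

lemma pr_Cons_right:
  "pr f (j # k) = lin_form (comul q deg_d f)
    (\<lambda>(f1, f2). \<chi> (deg deg_d f2) (deg_x j) * (pr f1 [j] * pr f2 k))"
proof -
  have "\<forall>f h k. pair_ext pr (bas f) (mul (h, k)) = lin_form (comul q deg_d f) (\<lambda>(f1, f2).
        lin_form (braid q deg_d deg_x (f2, h)) (\<lambda>(h', f2'). pr f1 h' * pr f2' k))"
    using pairing unfolding hopf_pairing_def by (elim conjE)
  from this[rule_format, of f "[j]" k] show ?thesis
    by (simp add: pair_ext_def mul_def braid_def)
qed

text \<open>The flip contained in the braiding has been carried out: the second coproduct factor is
  paired with \<open>f\<close> and the first one survives.\<close>

definition act :: "(('n \<Rightarrow> int) \<Rightarrow> ('n \<Rightarrow> int) \<Rightarrow> 'r) \<Rightarrow> 'n list \<Rightarrow> 'n list \<Rightarrow> ('n list \<Rightarrow>\<^sub>0 'r)" where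
  "act b f k = comul q deg_x k \<bind> (\<lambda>(k1, k2). scl (b (deg deg_x k1) (deg deg_x k2) * pr f k2) (bas k1))"

lemma act_l_eq: "act_l q pr (heis_braiding b) (f, k) = act b f k"
  by (simp add: act_l_def act_def heis_braiding_def lin_assoc split_def)

text \<open>Left multiplication by \<open>1 \<otimes> f\<close> on a basis vector. The product of
  the double is \<open>dmul\<close> followed by \<open>lmul\<close>.\<close>

definition dmul where
  "dmul b f = (\<lambda>(k, g). comul q deg_d f \<bind> (\<lambda>(f1, f2).
    scl (\<chi> (deg deg_d f2) (deg deg_x k)) (tens (act b f1 k) (bas (f2 @ g)))))"

lemma heis_mul_eq:
  "heis_mul q pr (heis_braiding b) P P' = (P \<bind> (\<lambda>(h, f). lmul (bas h) (P' \<bind> dmul b f)))"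
  by (simp add: heis_mul_def act_l_eq mul_def braid_def split_def dmul_def lmul_lin_right lmul_tens
      lin_append_tens)

abbreviation "heis_rel \<equiv> tens_rel (sq_ideal q deg_x) (sq_ideal q deg_d)"

text \<open>The action sees \<open>f\<close> only through the pairing, which vanishes on relations;
  the result is zero exactly, not merely modulo the ideal.\<close>

lemma act_sq_left: "F \<in> sq_ideal q deg_d \<Longrightarrow> F \<bind> (\<lambda>f. act b f k) = 0"
proof -
  assume F: "F \<in> sq_ideal q deg_d"
  have "F \<bind> (\<lambda>f. act b f k) = (comul q deg_x k \<bind> (\<lambda>kk.
      F \<bind> (\<lambda>f. scl (b (deg deg_x (fst kk)) (deg deg_x (snd kk)) * pr f (snd kk)) (bas (fst kk)))))"
    unfolding act_def split_def by (rule lin_commute)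
  also have "\<dots> = 0"
    by (simp add: lin_scl_right pr_sq_left[OF F] flip: fm.scale_scale scl_lin_form)
  finally show ?thesis .
qed

text \<open>By \<open>comul_sq_ideal\<close> a relation splits into two kinds of terms. Those with a
  relation on the left stay in the ideal, and those with a relation on the right are killed by the
  pairing.\<close>

lemma act_sq_right: "G \<in> sq_ideal q deg_x \<Longrightarrow> G \<bind> act b f \<in> sq_ideal q deg_x"
proof -
  assume G: "G \<in> sq_ideal q deg_x"
  let ?F = "\<lambda>(k1, k2). scl (b (deg deg_x k1) (deg deg_x k2) * pr f k2) (bas k1)"
  have "G \<bind> comul q deg_x \<bind> ?F \<in> sq_ideal q deg_x"
    using module_hom_lin subspace_sq_ideal
  proof (rule module_hom_tens_rel[OF _ _ _ _ comul_sq_ideal[OF _ G]])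
    fix p k2 assume "p \<in> sq_ideal q deg_x"
    then show "tens p (bas k2) \<bind> ?F \<in> sq_ideal q deg_x"
      by (simp add: tens_lin sq_ideal_graded[where m = "\<lambda>d. b d (deg deg_x k2) * pr f k2"])
  next
    fix k1 p' assume "p' \<in> sq_ideal q deg_x"
    then have "p' \<bind> (\<lambda>k2. scl (b (deg deg_x k1) (deg deg_x k2)) (scl (pr f k2) (bas k1))) \<in> {0}"
      by (rule sq_ideal_lin[rotated]) (simp_all add: pr_sq_right flip: scl_lin_form)
    then show "tens (bas k1) p' \<bind> ?F \<in> sq_ideal q deg_x"
      by (simp add: tens_lin fm.subspace_0)
  qed simp
  then show ?thesis by (simp add: lin_assoc act_def[abs_def])
qed

lemma lmul_rel_left: "p \<in> sq_ideal q deg_x \<Longrightarrow> lmul p P \<in> heis_rel"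
  unfolding lmul_def
  by (intro lin_mem_subspace) (auto simp: split_def intro!: tens_rel_left sq_ideal_mult_right)

lemma lmul_rel_right:
  assumes "P \<in> heis_rel"
  shows "lmul p P \<in> heis_rel"
  unfolding lmul_def using module_hom_lin subspace_tens_rel
  by (rule module_hom_tens_rel[OF _ _ _ _ assms])
    (auto simp flip: lmul_def simp: lmul_tens intro: tens_rel_left tens_rel_right sq_ideal_mult_left)

text \<open>Again the coproduct of a relation splits: a relation in the first component acts by
  zero, one in the second ends up in the right tensor factor.\<close>

lemma dmul_rel_left:
  assumes F: "F \<in> sq_ideal q deg_d"
  shows "F \<bind> (\<lambda>f. P \<bind> dmul b f) \<in> heis_rel"
proof -
  have "F \<bind> (\<lambda>f. dmul b f (k, g)) \<in> heis_rel" for k g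
  proof -
    let ?F = "\<lambda>(f1, f2). scl (\<chi> (deg deg_d f2) (deg deg_x k)) (tens (act b f1 k) (bas (f2 @ g)))"
    have "F \<bind> comul q deg_d \<bind> ?F \<in> heis_rel"
      using module_hom_lin subspace_tens_rel
    proof (rule module_hom_tens_rel[OF _ _ _ _ comul_sq_ideal[OF _ F]])
      fix p f2 assume "p \<in> sq_ideal q deg_d"
      then show "tens p (bas f2) \<bind> ?F \<in> heis_rel"
        by (simp add: tens_lin lin_scl_right act_sq_left fm.subspace_0 flip: tens_lin_left)
    next
      fix f1 p' assume "p' \<in> sq_ideal q deg_d"
      then have "p' \<bind> (\<lambda>f2. scl (\<chi> (deg deg_d f2) (deg deg_x k)) (tens (act b f1 k) (bas (f2 @ g)))) \<in> heis_rel"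
      proof (rule sq_ideal_lin[rotated])
        fix p assume "p \<in> sq_ideal q deg_d"
        then have "tens (act b f1 k) (p * bas g) \<in> heis_rel"
          by (intro tens_rel_right sq_ideal_mult_right)
        then show "p \<bind> (\<lambda>f2. tens (act b f1 k) (bas (f2 @ g))) \<in> heis_rel"
          by (simp add: mult_eq_lin tens_lin_right)
      qed simp
      then show "tens (bas f1) p' \<bind> ?F \<in> heis_rel"
        by (simp add: tens_lin)
    qed simp
    then show ?thesis by (simp add: lin_assoc dmul_def)
  qed
  then have "P \<bind> (\<lambda>kg. F \<bind> (\<lambda>f. dmul b f kg)) \<in> heis_rel"
    by (intro lin_mem_subspace[OF subspace_tens_rel, of P]) auto
  then show ?thesis by (subst lin_commute)
qed

lemma dmul_rel_right:
  assumes P: "P \<in> heis_rel"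
  shows "P \<bind> dmul b f \<in> heis_rel"
  using module_hom_lin subspace_tens_rel
proof (rule module_hom_tens_rel[OF _ _ _ _ P])
  fix p g assume p: "p \<in> sq_ideal q deg_x"
  have "p \<bind> (\<lambda>k. scl (\<chi> (deg deg_d f2) (deg deg_x k)) (tens (act b f1 k) (bas (f2 @ g)))) \<in> heis_rel" for f1 f2
    using p
  proof (rule sq_ideal_lin[rotated])
    fix p assume "p \<in> sq_ideal q deg_x"
    then show "p \<bind> (\<lambda>k. tens (act b f1 k) (bas (f2 @ g))) \<in> heis_rel"
      by (auto simp flip: tens_lin_left intro: tens_rel_left act_sq_right)
  qed simp
  then have "comul q deg_d f \<bind> (\<lambda>ff. p \<bind> (\<lambda>k. scl (\<chi> (deg deg_d (snd ff)) (deg deg_x k))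
      (tens (act b (fst ff) k) (bas (snd ff @ g))))) \<in> heis_rel"
    by (rule lin_mem_subspace[OF subspace_tens_rel])
  then show "tens p (bas g) \<bind> dmul b f \<in> heis_rel"
    by (subst (asm) lin_commute) (simp add: tens_lin dmul_def split_def)
next
  fix k p' assume p': "p' \<in> sq_ideal q deg_d"
  have "tens (bas k) p' \<bind> dmul b f = (comul q deg_d f \<bind> (\<lambda>ff.
      p' \<bind> (\<lambda>g. scl (\<chi> (deg deg_d (snd ff)) (deg deg_x k)) (tens (act b (fst ff) k) (bas (snd ff @ g))))))"
    by (subst lin_commute) (simp add: tens_lin dmul_def split_def)
  also have "\<dots> = (comul q deg_d f \<bind> (\<lambda>ff.
      scl (\<chi> (deg deg_d (snd ff)) (deg deg_x k)) (tens (act b (fst ff) k) (bas (snd ff) * p'))))"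
    by (simp add: lin_scl_right mult_eq_lin tens_lin_right)
  also have "\<dots> \<in> heis_rel"
    by (intro lin_mem_subspace subspace_tens_rel fm.subspace_scale tens_rel_right sq_ideal_mult_left p')
  finally show "tens (bas k) p' \<bind> dmul b f \<in> heis_rel" .
qed

abbreviation "hmul b \<equiv> heis_mul q pr (heis_braiding b)"

lemma hmul_tens: "hmul b (tens p p') P = lmul p (p' \<bind> (\<lambda>f. P \<bind> dmul b f))"
proof -
  have "hmul b (tens p p') P = (p \<bind> (\<lambda>h. lmul (bas h) (p' \<bind> (\<lambda>f. P \<bind> dmul b f))))"
    by (simp add: heis_mul_eq tens_lin lmul_lin_right)
  then show ?thesis by (simp flip: lmul_lin_left)
qed

lemma bilinear_compat_hmul: "bilinear_compat heis_rel (hmul b)"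
  unfolding bilinear_compat_def
proof (intro conjI allI impI)
  show "module_hom scl scl (hmul b P)" for P
    by unfold_locales (simp_all add: heis_mul_eq split_def lin_add_right lin_scl_right)
  show "module_hom scl scl (\<lambda>P. hmul b P P')" for P'
    by unfold_locales (simp_all add: heis_mul_eq)
  show "hmul b P P' \<in> heis_rel" if "P' \<in> heis_rel" for P P'
    unfolding heis_mul_eq
    by (intro lin_mem_subspace) (auto simp: split_def intro!: lmul_rel_right dmul_rel_right that)
  show "hmul b P P' \<in> heis_rel" if "P \<in> heis_rel" for P P'
    using \<open>module_hom scl scl (\<lambda>P. hmul b P P')\<close> subspace_tens_rel _ _ that
  proof (rule module_hom_tens_rel)
    show "hmul b (tens p (bas f)) P' \<in> heis_rel" if "p \<in> sq_ideal q deg_x" for p f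
      unfolding hmul_tens by (rule lmul_rel_left[OF that])
    show "hmul b (tens (bas h) p') P' \<in> heis_rel" if "p' \<in> sq_ideal q deg_d" for h p'
      unfolding hmul_tens by (rule lmul_rel_right[OF dmul_rel_left[OF that]])
  qed
qed simp

end

section \<open>The left action with the inverse braiding\<close>

lemma module_hom_mult_left: "module_hom scl scl (\<lambda>p'. p * (p' :: 'a list \<Rightarrow>\<^sub>0 'r::comm_ring_1))"
  using module_hom_mult[of p 1] by simp

lemma module_hom_mult_right: "module_hom scl scl (\<lambda>p. p * (p' :: 'a list \<Rightarrow>\<^sub>0 'r::comm_ring_1))"
  using module_hom_mult[of 1 p'] by simp

lemma bilinear_compat_ideal_gen: "bilinear_compat (ideal_gen S) (*)"
  by (auto simp: bilinear_compat_def ideal_gen_mult_left ideal_gen_mult_right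
      intro: module_hom_mult_left module_hom_mult_right)

text \<open>
  Induction produces \<open>\<eta>\<close>-expanded degrees; the pointwise rules would then rewrite below the
  abstraction and hide the sums from \<open>bichar_add_left\<close>.
\<close>

declare plus_fun_apply [simp del] zero_fun_apply [simp del] uminus_apply [simp del]

context hopf_paired
begin

lemma pr_nonzero_length: "pr f h \<noteq> 0 \<Longrightarrow> length h = length f"
  using sum_deg_x[of f] sum_deg_x[of h] pr_nonzero_deg[of f h] by (simp add: deg_deg_d uminus_apply)

text \<open>The counit axiom followed by an arbitrary map \<open>G\<close>, so that it can be used
  inside weighted sums.\<close>

lemma comul_counit_left:
  "comul q \<delta> f \<bind> (\<lambda>(c, d). if c = [] then G d else 0) = G f"
  by (induction f arbitrary: G)
    (simp_all add: comul_Nil comul_Cons lin_assoc split_def if_distrib[of "scl _"] cong: if_cong)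

lemma comul_counit_right:
  "comul q \<delta> f \<bind> (\<lambda>(c, d). if d = [] then G c else 0) = G f"
proof (induction f arbitrary: G)
  case (Cons a f)
  show ?case using Cons[of "\<lambda>c. G (a # c)"] by (simp add: comul_Cons lin_assoc split_def cong: if_cong)
qed (simp add: comul_Nil)

text \<open>The weight of the inverse braiding, with a negated degree in place of
  \<open>unit_inv\<close> so that bimultiplicativity applies directly.\<close>

definition inv_weight :: "('n \<Rightarrow> int) \<Rightarrow> ('n \<Rightarrow> int) \<Rightarrow> 'r" where
  "inv_weight d d' = \<chi> (- d') d"

abbreviation "ract \<equiv> act inv_weight"

lemma act_Nil_left:
  assumes "\<And>d. b d 0 = 1"
  shows "act b [] k = bas k"
proof -
  have "act b [] k = (comul q deg_x k \<bind> (\<lambda>(c, d). if d = [] then bas c else 0))"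
    by (auto simp: act_def pr_Nil_left assms intro!: lin_cong)
  then show ?thesis by (simp add: comul_counit_right)
qed

lemma ract_Nil_left: "ract [] k = bas k"
  by (rule act_Nil_left) (simp add: inv_weight_def)

lemma act_Nil_right: "f \<noteq> [] \<Longrightarrow> act b f [] = 0"
  by (simp add: act_def comul_Nil pr_Nil_right)

lemma ract_Nil_right: "ract f [] = (if f = [] then bas [] else 0)"
  by (simp add: act_def comul_Nil pr_Nil_right inv_weight_def)

text \<open>The coproduct preserves the degree and the pairing has degree zero, so the surviving
  factor has the sum of the two degrees.\<close>

lemma deg_act:
  assumes "k' \<in> Poly_Mapping.keys (act b f k)"
  shows "deg deg_x k' = deg deg_d f + deg deg_x k"
proof -
  have "k' \<in> (\<Union>cd\<in>Poly_Mapping.keys (comul q deg_x k). Poly_Mapping.keys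
      ((\<lambda>(k1, k2). scl (b (deg deg_x k1) (deg deg_x k2) * pr f k2) (bas k1)) cd))"
    using assms keys_lin unfolding act_def by fast
  then obtain c d where cd: "(c, d) \<in> Poly_Mapping.keys (comul q deg_x k)"
    and "k' \<in> Poly_Mapping.keys (scl (b (deg deg_x c) (deg deg_x d) * pr f d) (bas c))"
    by auto
  then have "k' = c" "pr f d \<noteq> 0"
    by (auto simp: in_keys_iff lookup_single when_def split: if_splits)
  with deg_comul[OF cd] pr_nonzero_deg[of f d] show ?thesis
    by (simp add: algebra_simps)
qed

lemma deg_act_single:
  "k' \<in> Poly_Mapping.keys (act b [i] k) \<Longrightarrow> deg deg_x k' = deg_d i + deg deg_x k"
  using deg_act[of k' b "[i]" k] by simp

text \<open>
  In the double, \<open>f x\<^sub>j = \<chi>(deg f, e\<^sub>j) x\<^sub>j f + right_deriv j f\<close>.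
\<close>

definition right_deriv :: "'n \<Rightarrow> 'n list \<Rightarrow> ('n list \<Rightarrow>\<^sub>0 'r)" where
  "right_deriv j f = comul q deg_d f \<bind>
    (\<lambda>(f1, f2). scl (\<chi> (deg deg_d f2) (deg_x j) * pr f1 [j]) (bas f2))"

lemma right_deriv_Nil: "right_deriv j [] = 0"
  by (simp add: right_deriv_def comul_Nil pr_Nil_left)

text \<open>In the coproduct of \<open>i # f\<close> the letter \<open>i\<close> goes left or right.
  On the left it can pair with \<open>[j]\<close> only when it stands alone, and the counit axiom
  collapses that sum.\<close>

lemma right_deriv_Cons:
  "right_deriv j (i # f) = scl (if i = j then \<chi> (deg deg_d f) (deg_x j) else 0) (bas f) +
    (right_deriv j f \<bind> (\<lambda>f'. bas (i # f')))"
proof -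
  have "pr (i # c) [j] = (if c = [] \<and> i = j then 1 else 0)" for c
    using pr_nonzero_length[of "i # c" "[j]"] by (cases "c = []") (auto simp: pr_single)
  then have "(comul q deg_d f \<bind> (\<lambda>(c, d). scl (\<chi> (deg deg_d d) (deg_x j) * pr (i # c) [j]) (bas d))) =
      (comul q deg_d f \<bind> (\<lambda>(c, d).
         if c = [] then scl (if i = j then \<chi> (deg deg_d d) (deg_x j) else 0) (bas d) else 0))"
    by (intro lin_cong) auto
  also have "\<dots> = scl (if i = j then \<chi> (deg deg_d f) (deg_x j) else 0) (bas f)"
    by (rule comul_counit_left)
  finally have 1: "(comul q deg_d f \<bind> (\<lambda>(c, d). scl (\<chi> (deg deg_d d) (deg_x j) * pr (i # c) [j]) (bas d))) = \<dots>" .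
  \<comment> \<open>Where the pairing is nonzero, \<open>c\<close> has degree
    \<open>- deg_x j\<close>. The weight for moving \<open>i\<close> across \<open>c\<close> then
    cancels the weight of \<open>i\<close> against \<open>deg_x j\<close>.\<close>
  have "\<chi> (deg_d i) (deg deg_d c) * (\<chi> (deg_d i + deg deg_d d) (deg_x j) * pr c [j]) =
      \<chi> (deg deg_d d) (deg_x j) * pr c [j]" for c d
  proof (cases "pr c [j] = 0")
    case False
    then have "deg deg_d c = - deg_x j" using pr_nonzero_deg[of c "[j]"] by simp
    then have "\<chi> (deg_d i) (deg deg_d c) * \<chi> (deg_d i) (deg_x j) = 1"
      by (simp only: bichar_minus_right bichar_inv_left)
    then have "\<chi> (deg_d i) (deg deg_d c) * (\<chi> (deg_d i) (deg_x j) * y) = y" for y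
      by (simp only: mult_1_left flip: mult.assoc)
    then show ?thesis by (simp only: bichar_add_left mult.assoc)
  qed simp
  then have 2: "(comul q deg_d f \<bind> (\<lambda>(c, d). scl (\<chi> (deg_d i) (deg deg_d c) *
        (\<chi> (deg_d i + deg deg_d d) (deg_x j) * pr c [j])) (bas (i # d)))) =
      (right_deriv j f \<bind> (\<lambda>f'. bas (i # f')))"
    by (simp add: right_deriv_def lin_assoc split_def)
  have "right_deriv j (i # f) =
      (comul q deg_d f \<bind> (\<lambda>(c, d). scl (\<chi> (deg deg_d d) (deg_x j) * pr (i # c) [j]) (bas d))) +
      (comul q deg_d f \<bind> (\<lambda>(c, d). scl (\<chi> (deg_d i) (deg deg_d c) *
        (\<chi> (deg_d i + deg deg_d d) (deg_x j) * pr c [j])) (bas (i # d))))"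
    by (simp add: right_deriv_def comul_Cons lin_assoc split_def lin_add_right)
  then show ?thesis by (simp only: 1 2)
qed

text \<open>The skew Leibniz rule for a whole word \<open>f\<close>. The first summand comes from
  coproduct terms in which \<open>j\<close> survives, the second from those in which
  \<open>j\<close> is paired, expanded by \<open>pr_Cons_right\<close>.\<close>

lemma ract_Cons_right:
  "ract f (j # k) = scl (\<chi> (deg deg_d f) (deg_x j)) (bas [j] * ract f k) +
    (right_deriv j f \<bind> (\<lambda>f'. ract f' k))"
proof -
  have "(comul q deg_x k \<bind> (\<lambda>(c, d). scl (\<chi> (- deg deg_x d) (deg_x j + deg deg_x c) * pr f d) (bas (j # c)))) =
      (comul q deg_x k \<bind> (\<lambda>(c, d). scl (\<chi> (deg deg_d f) (deg_x j))
         (scl (\<chi> (- deg deg_x d) (deg deg_x c) * pr f d) (bas (j # c)))))"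
  proof (rule lin_cong, clarify)
    fix c d
    have "\<chi> (- deg deg_x d) (deg_x j + deg deg_x c) * pr f d =
        \<chi> (deg deg_d f) (deg_x j) * (\<chi> (- deg deg_x d) (deg deg_x c) * pr f d)"
      by (cases "pr f d = 0") (simp_all add: bichar_add_right pr_nonzero_deg[of f d] mult.assoc)
    then show "scl (\<chi> (- deg deg_x d) (deg_x j + deg deg_x c) * pr f d) (bas (j # c)) =
        scl (\<chi> (deg deg_d f) (deg_x j)) (scl (\<chi> (- deg deg_x d) (deg deg_x c) * pr f d) (bas (j # c)))"
      by simp
  qed
  also have "\<dots> = scl (\<chi> (deg deg_d f) (deg_x j)) (bas [j] * ract f k)"
    by (simp add: split_def lin_scl_right act_def inv_weight_def lin_mult_right del: fm.scale_scale)
  finally have 1: "(comul q deg_x k \<bind> (\<lambda>(c, d).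
      scl (\<chi> (- deg deg_x d) (deg_x j + deg deg_x c) * pr f d) (bas (j # c)))) = \<dots>" .
  \<comment> \<open>Here the inverse weight is essential: it cancels the crossing weight of the
    coproduct. The braiding itself would leave the factor
    \<open>\<chi> c (deg_x j) * \<chi> (deg_x j) c\<close>.\<close>
  have "\<chi> (deg_x j) c * \<chi> (- (deg_x j + d)) c = \<chi> (- d) c" for c d
    by (simp only: flip: bichar_add_left) simp
  then have chi: "\<chi> (deg_x j) c * (\<chi> (- (deg_x j + d)) c * y) = \<chi> (- d) c * y" for c d y
    by (simp only: flip: mult.assoc)
  have "(comul q deg_x k \<bind> (\<lambda>(c, d). scl (\<chi> (- deg deg_x d) (deg deg_x c) * pr f (j # d)) (bas c))) =
      (comul q deg_x k \<bind> (\<lambda>cd. comul q deg_d f \<bind> (\<lambda>ff.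
        scl (\<chi> (- deg deg_x (snd cd)) (deg deg_x (fst cd)) *
          (\<chi> (deg deg_d (snd ff)) (deg_x j) * (pr (fst ff) [j] * pr (snd ff) (snd cd)))) (bas (fst cd)))))"
  proof (rule lin_cong)
    fix cd
    let ?b = "\<chi> (- deg deg_x (snd cd)) (deg deg_x (fst cd))"
    have "scl (?b * pr f (j # snd cd)) (bas (fst cd)) = scl ?b (scl (pr f (j # snd cd)) (bas (fst cd)))"
      by simp
    also have "\<dots> = scl ?b (comul q deg_d f \<bind> (\<lambda>ff.
        scl (\<chi> (deg deg_d (snd ff)) (deg_x j) * (pr (fst ff) [j] * pr (snd ff) (snd cd))) (bas (fst cd))))"
      unfolding pr_Cons_right[of f j "snd cd"] scl_lin_form split_def ..
    also have "\<dots> = (comul q deg_d f \<bind> (\<lambda>ff. scl (?b *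
        (\<chi> (deg deg_d (snd ff)) (deg_x j) * (pr (fst ff) [j] * pr (snd ff) (snd cd)))) (bas (fst cd))))"
      unfolding lin_scl_right[symmetric] fm.scale_scale ..
    finally show "(case cd of (c, d) \<Rightarrow>
        scl (\<chi> (- deg deg_x d) (deg deg_x c) * pr f (j # d)) (bas c)) = \<dots>"
      by (simp add: split_def)
  qed
  also have "\<dots> = (right_deriv j f \<bind> (\<lambda>f'. ract f' k))"
  proof -
    have "(right_deriv j f \<bind> (\<lambda>f'. ract f' k)) = (comul q deg_d f \<bind> (\<lambda>ff.
        scl (\<chi> (deg deg_d (snd ff)) (deg_x j) * pr (fst ff) [j]) (comul q deg_x k \<bind> (\<lambda>cd.
          scl (\<chi> (- deg deg_x (snd cd)) (deg deg_x (fst cd)) * pr (snd ff) (snd cd)) (bas (fst cd))))))"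
      by (simp add: right_deriv_def act_def inv_weight_def split_def lin_assoc)
    then show ?thesis
      unfolding lin_scl_right[symmetric] fm.scale_scale by (subst lin_commute) (simp add: mult_ac)
  qed
  finally have 2: "(comul q deg_x k \<bind> (\<lambda>(c, d). scl (\<chi> (- deg deg_x d) (deg deg_x c) * pr f (j # d)) (bas c))) = \<dots>" .
  have "ract f (j # k) =
      (comul q deg_x k \<bind> (\<lambda>(c, d). scl (\<chi> (- deg deg_x d) (deg_x j + deg deg_x c) * pr f d) (bas (j # c)))) +
      (comul q deg_x k \<bind> (\<lambda>(c, d). scl (\<chi> (- deg deg_x d) (deg deg_x c) * pr f (j # d)) (bas c)))"
    unfolding act_def inv_weight_def comul_Cons
    by (simp add: lin_assoc split_def lin_add_right chi del: minus_add_distrib)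
  then show ?thesis by (simp only: 1 2)
qed

lemma right_deriv_single: "right_deriv j [i] = scl (if i = j then 1 else 0) (bas [])"
  by (simp add: right_deriv_Cons right_deriv_Nil)

lemma ract_single_Cons:
  "ract [i] (j # k) =
    scl (unit_inv (q i j)) (bas [j] * ract [i] k) + scl (if i = j then 1 else 0) (bas k)"
  by (simp add: ract_Cons_right right_deriv_single ract_Nil_left)

lemma ract_single_mult:
  "bas [j] * p \<bind> ract [i] =
    scl (unit_inv (q i j)) (bas [j] * (p \<bind> ract [i])) + scl (if i = j then 1 else 0) p"
  by (simp add: mult_eq_lin[of "bas [j]" p] lin_assoc ract_single_Cons lin_add_right lin_scl_right
      lin_mult_right)

text \<open>
  The module axiom for the inverse braiding, by induction on \<open>k\<close> through \<open>ract_Cons_right\<close>; this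
  avoids coassociativity of \<open>\<Delta>\<close>.
\<close>

lemma ract_Cons_left: "ract (i # f) k = (ract f k \<bind> ract [i])"
proof (induction k arbitrary: f)
  case Nil
  then show ?case by (simp add: ract_Nil_right)
next
  case (Cons j k)
  have "right_deriv j (i # f) \<bind> (\<lambda>f'. ract f' k) =
      scl (if i = j then \<chi> (deg deg_d f) (deg_x j) else 0) (ract f k) +
      (right_deriv j f \<bind> (\<lambda>f'. ract f' k) \<bind> ract [i])"
    by (simp add: right_deriv_Cons lin_assoc Cons)
  then show ?case
    by (simp add: ract_Cons_right[of f] ract_Cons_right[of "i # f"] ract_single_mult Cons
        bichar_add_left mult_ac add_ac)
qed

text \<open>The skew Leibniz rule gives this on the tensor algebra itself, not only modulo the
  relations among the x letters.\<close>

lemma ract_commute: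
  assumes "i \<noteq> j"
  shows "(ract [j] k \<bind> ract [i]) = scl (q i j) (ract [i] k \<bind> ract [j])"
proof (induction k)
  case Nil
  then show ?case by (simp add: ract_Nil_right)
next
  case (Cons l k)
  have 1: "q i j * unit_inv (q i j) = 1" by (rule unit_inv_right[OF q_unit])
  then have 3: "q i j * (unit_inv (q i j) * y) = y" for y by (simp only: mult_1_left flip: mult.assoc)
  have 2: "unit_inv (q j i) = q i j" by (rule unit_inv_eqI) (rule q_swap[OF assms[symmetric]])
  consider "l = i" | "l = j" | "l \<noteq> i" "l \<noteq> j" by blast
  then show ?case
    using assms 1 by cases (simp_all add: ract_single_Cons ract_single_mult Cons 3 2 mult_ac)
qed

lemma ract_append: "ract [i] (h @ k) =
    ract [i] h * bas k + scl (\<chi> (deg_d i) (deg deg_x h)) (bas h * ract [i] k)"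
proof (induction h)
  case Nil
  show ?case by (simp add: ract_Nil_right)
next
  case (Cons j h)
  have "bas [j] * (bas h * p) = bas (j # h) * p" for p :: "'n list \<Rightarrow>\<^sub>0 'r"
    by (simp flip: mult.assoc)
  then show ?case
    by (simp add: ract_single_Cons Cons distrib_left distrib_right bichar_add_right mult.assoc)
qed

section \<open>Left multiplication by words in the \<partial> letters\<close>

abbreviation "dmul\<^sub>0 \<equiv> dmul inv_weight"

lemma dmul_Nil: "(\<And>d. b d 0 = 1) \<Longrightarrow> dmul b [] = bas"
  by (simp add: fun_eq_iff dmul_def comul_Nil act_Nil_left)

lemma dmul0_Nil: "dmul\<^sub>0 [] = bas"
  by (rule dmul_Nil) (simp add: inv_weight_def)

lemma dmul_single: "(\<And>d. b d 0 = 1) \<Longrightarrow>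
  dmul b [i] (k, g) = tens (act b [i] k) (bas g) + scl (\<chi> (deg_d i) (deg deg_x k)) (bas (k, i # g))"
  by (simp add: dmul_def comul_Nil comul_Cons act_Nil_left)

lemma dmul0_single: "dmul\<^sub>0 [i] = skew_step deg_d deg_x (\<lambda>i. ract [i]) i"
  by (simp add: fun_eq_iff dmul_def comul_Nil comul_Cons skew_step_def ract_Nil_left)

text \<open>The two terms of \<open>comul_Cons\<close> match the two terms of
  \<open>skew_step\<close>; the first match is the module axiom \<open>ract_Cons_left\<close>, the
  second uses homogeneity of the action.\<close>

lemma dmul_Cons: "dmul\<^sub>0 (i # f) kg = (dmul\<^sub>0 f kg \<bind> dmul\<^sub>0 [i])"
proof -
  obtain k g where kg: "kg = (k, g)" by (cases kg)
  have *: "(ract c k \<bind> (\<lambda>k'. scl (\<chi> (deg_d i) (deg deg_x k')) (bas k'))) =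
      scl (\<chi> (deg_d i) (deg deg_d c) * \<chi> (deg_d i) (deg deg_x k)) (ract c k)" for c
  proof -
    have "(ract c k \<bind> (\<lambda>k'. scl (\<chi> (deg_d i) (deg deg_x k')) (bas k'))) =
        (ract c k \<bind> (\<lambda>k'. scl (\<chi> (deg_d i) (deg deg_d c) * \<chi> (deg_d i) (deg deg_x k)) (bas k')))"
      by (rule lin_cong) (simp add: deg_act bichar_add_right)
    then show ?thesis by (simp add: lin_scl_right)
  qed
  show ?thesis
    by (simp add: kg dmul0_single) (simp add: dmul_def comul_Cons lin_assoc split_def tens_skew_step
        ract_Cons_left[of i "fst _"] * bichar_add_left mult_ac)
qed

lemma lin_dmul_Cons: "P \<bind> dmul\<^sub>0 (i # f) = (P \<bind> dmul\<^sub>0 f \<bind> dmul\<^sub>0 [i])"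
  by (simp add: lin_assoc flip: dmul_Cons)

lemma dmul_lmul:
  "lmul (bas h) P \<bind> dmul\<^sub>0 [i] =
    lmul (ract [i] h) P + scl (\<chi> (deg_d i) (deg deg_x h)) (lmul (bas h) (P \<bind> dmul\<^sub>0 [i]))"
proof -
  have "dmul\<^sub>0 [i] (h @ k, g) = tens (ract [i] h * bas k) (bas g) +
      scl (\<chi> (deg_d i) (deg deg_x h)) (lmul (bas h) (dmul\<^sub>0 [i] (k, g)))" for k g
    by (simp add: dmul0_single skew_step_def ract_append lmul_tens bichar_add_right)
  then show ?thesis
    by (simp add: lmul_lin_right lin_scl_right[symmetric] lin_add_right[symmetric])
       (simp add: lmul_def lin_assoc split_def lin_add_right)
qed

section \<open>Comparison with the presented algebra\<close>

definition gen_op :: "'n gen \<Rightarrow> ('n list \<times> 'n list \<Rightarrow>\<^sub>0 'r) \<Rightarrow> ('n list \<times> 'n list \<Rightarrow>\<^sub>0 'r)" where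
  "gen_op g P = (case g of X j \<Rightarrow> lmul (bas [j]) P | D i \<Rightarrow> P \<bind> dmul\<^sub>0 [i])"

lemma module_hom_gen_op: "module_hom scl scl (gen_op g)"
  by unfold_locales (auto simp: gen_op_def split: gen.split)

lemma module_hom_word: "module_hom scl scl (foldr gen_op u)"
proof (induction u)
  case (Cons g u)
  interpret g: module_hom scl scl "gen_op g" by (rule module_hom_gen_op)
  interpret u: module_hom scl scl "foldr gen_op u" by (rule Cons)
  show ?case by unfold_locales (simp_all add: g.add u.add g.scale u.scale)
qed (unfold_locales, auto)

definition pres_map :: "('n gen list \<Rightarrow>\<^sub>0 'r) \<Rightarrow> ('n list \<times> 'n list \<Rightarrow>\<^sub>0 'r)" where
  "pres_map p = p \<bind> (\<lambda>w. foldr gen_op w (bas ([], [])))"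

abbreviation "hmul\<^sub>0 \<equiv> hmul inv_weight"

lemma hmul_lin: "hmul b (Q \<bind> F) P = (Q \<bind> (\<lambda>c. hmul b (F c) P))"
  by (simp add: heis_mul_eq lin_assoc)

lemma hmul_add_left: "hmul b (Q + Q') P = hmul b Q P + hmul b Q' P"
  by (simp add: heis_mul_eq)

lemma hmul_scl_left: "hmul b (scl c Q) P = scl c (hmul b Q P)"
  by (simp add: heis_mul_eq)

lemma hmul_bas: "hmul b (bas (h, f)) P = lmul (bas h) (P \<bind> dmul b f)"
  by (simp add: heis_mul_eq)

text \<open>Associativity with a generator as leftmost factor. For \<open>D i\<close> both sides
  move the generator past \<open>h\<close>, on the left by \<open>skew_step\<close> and on the right
  by \<open>dmul_lmul\<close>.\<close>

lemma hmul_gen_op_bas: "hmul\<^sub>0 (gen_op g (bas (h, f))) P = gen_op g (hmul\<^sub>0 (bas (h, f)) P)"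
proof (cases g)
  case (X j)
  then show ?thesis by (simp add: gen_op_def heis_mul_eq lmul_lmul)
next
  case (D i)
  have "hmul\<^sub>0 (dmul\<^sub>0 [i] (h, f)) P = hmul\<^sub>0 (tens (ract [i] h) (bas f)) P +
      scl (\<chi> (deg_d i) (deg deg_x h)) (hmul\<^sub>0 (bas (h, i # f)) P)"
    by (simp only: dmul0_single skew_step_def prod.case hmul_add_left hmul_scl_left)
  also have "\<dots> = (hmul\<^sub>0 (bas (h, f)) P \<bind> dmul\<^sub>0 [i])"
    by (simp add: hmul_tens hmul_bas dmul_lmul lin_dmul_Cons[of P i f])
  finally show ?thesis by (simp add: D gen_op_def)
qed

lemma hmul_gen_op: "hmul\<^sub>0 (gen_op g Q) P = gen_op g (hmul\<^sub>0 Q P)"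
proof -
  have "hmul\<^sub>0 (gen_op g Q) P = hmul\<^sub>0 (Q \<bind> (\<lambda>hf. gen_op g (bas hf))) P"
    by (simp flip: module_hom_lin_comm[OF module_hom_gen_op])
  also have "\<dots> = (Q \<bind> (\<lambda>hf. gen_op g (hmul\<^sub>0 (bas hf) P)))"
    unfolding hmul_lin by (rule lin_cong) (metis hmul_gen_op_bas surj_pair)
  also have "\<dots> = gen_op g (hmul\<^sub>0 (Q \<bind> bas) P)"
    unfolding hmul_lin module_hom_lin_comm[OF module_hom_gen_op] ..
  finally show ?thesis by simp
qed

text \<open>Repeated associativity for generators. It makes \<open>pres_map\<close> multiplicative
  before associativity of the double is known.\<close>

lemma foldr_gen_op: "foldr gen_op u P = hmul\<^sub>0 (foldr gen_op u (bas ([], []))) P"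
proof (induction u)
  case Nil
  then show ?case by (simp add: heis_mul_eq dmul0_Nil)
next
  case (Cons g u)
  then show ?case by (simp add: hmul_gen_op)
qed

lemma foldr_gen_op_lin: "foldr gen_op u (P \<bind> F) = (P \<bind> (\<lambda>b. foldr gen_op u (F b)))"
  by (rule module_hom_lin_comm[OF module_hom_word])

lemma module_hom_pres_map: "module_hom scl scl pres_map"
  unfolding pres_map_def[abs_def] by (rule module_hom_lin)

lemma pres_map_mult: "pres_map (p * p') = hmul\<^sub>0 (pres_map p) (pres_map p')"
proof -
  let ?w = "\<lambda>w. foldr gen_op w (bas ([], []))"
  have "pres_map (p * p') = (p \<bind> (\<lambda>v. foldr gen_op v (p' \<bind> ?w)))"
    by (simp add: pres_map_def mult_eq_lin lin_assoc foldr_gen_op_lin)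
  also have "\<dots> = (p \<bind> (\<lambda>v. hmul\<^sub>0 (?w v) (p' \<bind> ?w)))"
    by (simp flip: foldr_gen_op)
  also have "\<dots> = hmul\<^sub>0 (pres_map p) (pres_map p')"
    by (simp add: pres_map_def heis_mul_eq lin_assoc)
  finally show ?thesis .
qed

lemma gen_op_rel: "P \<in> heis_rel \<Longrightarrow> gen_op g P \<in> heis_rel"
  by (auto simp: gen_op_def lmul_rel_right dmul_rel_right split: gen.split)

lemma foldr_gen_op_rel: "P \<in> heis_rel \<Longrightarrow> foldr gen_op u P \<in> heis_rel"
  by (induction u) (auto intro: gen_op_rel)

text \<open>The left-factor term of \<open>skew_step_commutator\<close> vanishes by
  \<open>ract_commute\<close>, and the remaining term has a relation in its right factor.\<close>

lemma dmul_commutator: "i \<noteq> j \<Longrightarrow>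
  (P \<bind> dmul\<^sub>0 [j] \<bind> dmul\<^sub>0 [i]) - scl (q i j) (P \<bind> dmul\<^sub>0 [i] \<bind> dmul\<^sub>0 [j]) \<in> heis_rel"
proof -
  assume ij: "i \<noteq> j"
  have "(dmul\<^sub>0 [j] cd \<bind> dmul\<^sub>0 [i]) - scl (q i j) (dmul\<^sub>0 [i] cd \<bind> dmul\<^sub>0 [j]) \<in> heis_rel" for cd
  proof -
    obtain c d where cd: "cd = (c, d)" by (cases cd)
    have "(dmul\<^sub>0 [j] cd \<bind> dmul\<^sub>0 [i]) - scl (q i j) (dmul\<^sub>0 [i] cd \<bind> dmul\<^sub>0 [j]) =
        scl (\<chi> (deg_d i) (deg deg_x c) * \<chi> (deg_d j) (deg deg_x c)) (tens (bas c) (sq_rel i j * bas d))"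
      unfolding dmul0_single cd
      by (subst skew_step_commutator[OF deg_act_single bichar_deg_d bichar_deg_d ij])
        (simp_all only: ract_commute[OF ij] diff_self tens_linear add_0)
    also have "\<dots> \<in> heis_rel"
      by (intro fm.subspace_scale subspace_tens_rel tens_rel_right sq_ideal_mult_right sq_rel_mem)
        (simp_all add: ij)
    finally show ?thesis .
  qed
  then have "P \<bind> (\<lambda>cd. (dmul\<^sub>0 [j] cd \<bind> dmul\<^sub>0 [i]) - scl (q i j) (dmul\<^sub>0 [i] cd \<bind> dmul\<^sub>0 [j])) \<in> heis_rel"
    by (rule lin_mem_subspace[OF subspace_tens_rel])
  then show ?thesis by (simp add: lin_assoc lin_diff_right lin_scl_right)
qed

text \<open>Prefix words act by operators preserving \<open>heis_rel\<close>, so it suffices to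
  evaluate a relation followed by a word. The mixed relations even evaluate to zero, by the skew
  Leibniz rule.\<close>

lemma pres_map_rel:
  assumes "p \<in> ideal_gen (pres_rels q)"
  shows "pres_map p \<in> heis_rel"
  using module_hom_pres_map subspace_tens_rel _ assms
proof (rule module_hom_ideal_gen)
  fix u s v assume s: "s \<in> pres_rels q"
  let ?w = "\<lambda>w. foldr gen_op w (bas ([], []))"
  have u: "pres_map (bas u * p) = foldr gen_op u (pres_map p)" for u p
    by (simp add: pres_map_def mult_eq_lin lin_assoc foldr_gen_op_lin)
  have "pres_map (s * bas v) \<in> heis_rel"
  proof -
    let ?P = "pres_map (bas v)"
    from s consider
        (xx) i j where "i \<noteq> j" "s = bas [X i] * bas [X j] - scl (q i j) (bas [X j] * bas [X i])"
      | (dd) i j where "i \<noteq> j" "s = bas [D i] * bas [D j] - scl (q i j) (bas [D j] * bas [D i])"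
      | (dx) i j where "s = bas [D i] * bas [X j] - scl (unit_inv (q i j)) (bas [X j] * bas [D i])
          - (if i = j then 1 else 0)"
      unfolding pres_rels_def by blast
    then show ?thesis
    proof cases
      case xx
      have "pres_map (s * bas v) = lmul (sq_rel i j) ?P"
        by (simp add: xx left_diff_distrib pres_map_def gen_op_def lmul_lmul)
      then show ?thesis using xx by (simp add: lmul_rel_left sq_rel_mem del: lmul_diff_left)
    next
      case dd
      have "pres_map (s * bas v) =
          (?P \<bind> dmul\<^sub>0 [j] \<bind> dmul\<^sub>0 [i]) - scl (q i j) (?P \<bind> dmul\<^sub>0 [i] \<bind> dmul\<^sub>0 [j])"
        by (simp add: dd left_diff_distrib pres_map_def gen_op_def)
      then show ?thesis using dd by (simp add: dmul_commutator)
    next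
      case dx
      have "pres_map (s * bas v) = (lmul (bas [j]) ?P \<bind> dmul\<^sub>0 [i]) -
          scl (unit_inv (q i j)) (lmul (bas [j]) (?P \<bind> dmul\<^sub>0 [i])) - scl (if i = j then 1 else 0) ?P"
        by (simp add: dx left_diff_distrib pres_map_def gen_op_def)
      also have "\<dots> = 0"
        by (simp add: dmul_lmul ract_single_Cons ract_Nil_right)
      finally show ?thesis by (simp add: fm.subspace_0)
    qed
  qed
  then show "pres_map (bas u * s * bas v) \<in> heis_rel"
    by (simp add: u mult.assoc foldr_gen_op_rel)
qed

section \<open>Ordered words and straightening\<close>

definition emb_x :: "('n list \<Rightarrow>\<^sub>0 'r) \<Rightarrow> ('n gen list \<Rightarrow>\<^sub>0 'r)" where
  "emb_x p = p \<bind> (\<lambda>h. bas (map X h))"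

definition emb_d :: "('n list \<Rightarrow>\<^sub>0 'r) \<Rightarrow> ('n gen list \<Rightarrow>\<^sub>0 'r)" where
  "emb_d p = p \<bind> (\<lambda>f. bas (map D f))"

definition normal_form :: "('n list \<times> 'n list \<Rightarrow>\<^sub>0 'r) \<Rightarrow> ('n gen list \<Rightarrow>\<^sub>0 'r)" where
  "normal_form P = P \<bind> (\<lambda>(h, f). bas (map X h @ map D f))"

abbreviation "pres_ideal \<equiv> ideal_gen (pres_rels q)"

lemma normal_form_tens: "normal_form (tens p p') = emb_x p * emb_d p'"
  by (simp add: normal_form_def emb_x_def emb_d_def tens_lin lin_mult_left) (simp add: lin_mult_right)

lemma emb_x_rel: "p \<in> sq_ideal q deg_x \<Longrightarrow> emb_x p \<in> pres_ideal"
proof -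
  assume "p \<in> sq_ideal q deg_x"
  then have p: "p \<in> ideal_gen {sq_rel i j | i j. i \<noteq> j}" by (simp add: sq_ideal_eq)
  show ?thesis unfolding emb_x_def using module_hom_lin subspace_ideal_gen
  proof (rule module_hom_ideal_gen[OF _ _ _ p])
    fix u s v assume "s \<in> {sq_rel i j | i j. i \<noteq> j}"
    then obtain i j where s: "s = sq_rel i j" and ij: "i \<noteq> j" by auto
    have "bas u * s * bas v \<bind> (\<lambda>h. bas (map X h)) = bas (map X u) *
        (bas [X i] * bas [X j] - scl (q i j) (bas [X j] * bas [X i])) * bas (map X v)"
      by (simp add: s left_diff_distrib right_diff_distrib)
    also have "\<dots> \<in> pres_ideal"
      using ij by (intro ideal_gen_mult ideal_gen_base) (auto simp: pres_rels_def)
    finally show "bas u * s * bas v \<bind> (\<lambda>h. bas (map X h)) \<in> pres_ideal" .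
  qed
qed

lemma emb_d_rel: "p \<in> sq_ideal q deg_d \<Longrightarrow> emb_d p \<in> pres_ideal"
proof -
  assume "p \<in> sq_ideal q deg_d"
  then have p: "p \<in> ideal_gen {sq_rel i j | i j. i \<noteq> j}" by (simp add: sq_ideal_eq)
  show ?thesis unfolding emb_d_def using module_hom_lin subspace_ideal_gen
  proof (rule module_hom_ideal_gen[OF _ _ _ p])
    fix u s v assume "s \<in> {sq_rel i j | i j. i \<noteq> j}"
    then obtain i j where s: "s = sq_rel i j" and ij: "i \<noteq> j" by auto
    have "bas u * s * bas v \<bind> (\<lambda>h. bas (map D h)) = bas (map D u) *
        (bas [D i] * bas [D j] - scl (q i j) (bas [D j] * bas [D i])) * bas (map D v)"
      by (simp add: s left_diff_distrib right_diff_distrib)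
    also have "\<dots> \<in> pres_ideal"
      using ij by (intro ideal_gen_mult ideal_gen_base) (auto simp: pres_rels_def)
    finally show "bas u * s * bas v \<bind> (\<lambda>h. bas (map D h)) \<in> pres_ideal" .
  qed
qed

lemma normal_form_rel:
  assumes "P \<in> heis_rel"
  shows "normal_form P \<in> pres_ideal"
proof -
  have "module_hom scl scl normal_form"
    unfolding normal_form_def[abs_def] by (rule module_hom_lin)
  then show ?thesis using subspace_ideal_gen
    by (rule module_hom_tens_rel[OF _ _ _ _ assms])
      (auto simp: normal_form_tens intro: ideal_gen_mult_left ideal_gen_mult_right emb_x_rel emb_d_rel)
qed

text \<open>No correction terms arise: the \<partial> letters are applied first, while the left
  factor is still 1, where they act by zero and cross with weight 1.\<close>

lemma pres_map_normal_form: "pres_map (normal_form P) = P"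
proof -
  have d: "foldr gen_op (map D f) (bas ([], [])) = bas ([], f)" for f
    by (induction f) (simp_all add: gen_op_def dmul0_single skew_step_def ract_Nil_right)
  have "foldr gen_op (map X h) (bas ([], f)) = bas (h, f)" for h f
  proof (induction h)
    case (Cons j h)
    then show ?case by (simp add: gen_op_def)
  qed simp
  then show ?thesis
    by (simp add: pres_map_def normal_form_def lin_assoc split_def d)
qed

text \<open>Moving \<open>D i\<close> past one x letter costs one mixed relation, and its correction
  terms are exactly those of \<open>ract_single_Cons\<close>.\<close>

lemma straighten_x:
  "bas [D i] * bas (map X h) - emb_x (ract [i] h) -
    scl (\<chi> (deg_d i) (deg deg_x h)) (bas (map X h) * bas [D i]) \<in> pres_ideal"
proof (induction h)
  case Nil
  then show ?case by (simp add: ract_Nil_right emb_x_def fm.subspace_0)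
next
  case (Cons j h)
  let ?r = "bas [D i] * bas [X j] - scl (unit_inv (q i j)) (bas [X j] * bas [D i]) - (if i = j then 1 else 0)"
  let ?E = "\<lambda>h. bas [D i] * bas (map X h) - emb_x (ract [i] h) -
    scl (\<chi> (deg_d i) (deg deg_x h)) (bas (map X h) * bas [D i])"
  have "emb_x (bas [j] * p) = bas [X j] * emb_x p" for p
    by (simp add: emb_x_def mult_eq_lin lin_assoc)
  then have "emb_x (ract [i] (j # h)) = scl (unit_inv (q i j)) (bas [X j] * emb_x (ract [i] h)) +
      (if i = j then bas (map X h) else 0)"
    by (simp add: ract_single_Cons) (simp add: emb_x_def)
  then have "?E (j # h) = ?r * bas (map X h) + scl (unit_inv (q i j)) (bas [X j] * ?E h)"
    by (simp add: left_diff_distrib right_diff_distrib bichar_add_right flip: mult.assoc)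
  moreover have "?r \<in> pres_ideal"
    by (rule ideal_gen_base) (auto simp: pres_rels_def)
  ultimately show ?case
    using Cons by (simp only:) (intro fm.subspace_add subspace_ideal_gen fm.subspace_scale
        ideal_gen_mult_left ideal_gen_mult_right)
qed

lemma straighten_gen_op: "bas [g] * normal_form P - normal_form (gen_op g P) \<in> pres_ideal"
proof -
  have hom: "module_hom scl scl (\<lambda>P. bas [g] * normal_form P - normal_form (gen_op g P))"
    by unfold_locales (simp_all add: normal_form_def module_hom.add[OF module_hom_gen_op]
        module_hom.scale[OF module_hom_gen_op] distrib_left)
  have "bas [g] * normal_form (bas (h, f)) - normal_form (gen_op g (bas (h, f))) \<in> pres_ideal" for h f
  proof (cases g)
    case (X j)
    then show ?thesis
      by (simp add: gen_op_def normal_form_def fm.subspace_0)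
  next
    case (D i)
    have "bas [g] * normal_form (bas (h, f)) - normal_form (gen_op g (bas (h, f))) =
        (bas [D i] * bas (map X h) - emb_x (ract [i] h) -
          scl (\<chi> (deg_d i) (deg deg_x h)) (bas (map X h) * bas [D i])) * bas (map D f)"
    proof -
      have "normal_form (p + p') = normal_form p + normal_form p'"
        "normal_form (scl c p) = scl c (normal_form p)" for p p' c
        by (simp_all add: normal_form_def)
      then show ?thesis
        by (simp add: D gen_op_def dmul0_single skew_step_def normal_form_tens emb_d_def left_diff_distrib)
           (simp add: normal_form_def)
    qed
    then show ?thesis using straighten_x by (simp only: ideal_gen_mult_right)
  qed
  then have "P \<bind> (\<lambda>b. bas [g] * normal_form (bas b) - normal_form (gen_op g (bas b))) \<in> pres_ideal"
    by (intro lin_mem_subspace) auto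
  then show ?thesis
    using module_hom_lin_comm[OF hom, of P bas] by simp
qed

text \<open>Every word is congruent to a combination of ordered words, built up letter by letter.
  This gives injectivity of the induced map without a basis of the presented algebra.\<close>

lemma straighten: "p - normal_form (pres_map p) \<in> pres_ideal"
proof -
  let ?w = "\<lambda>w. foldr gen_op w (bas ([], []))"
  have "bas w - normal_form (?w w) \<in> pres_ideal" for w
  proof (induction w)
    case Nil
    then show ?case by (simp add: normal_form_def fm.subspace_0)
  next
    case (Cons g w)
    have "bas (g # w) - normal_form (?w (g # w)) =
        bas [g] * (bas w - normal_form (?w w)) +
        (bas [g] * normal_form (?w w) - normal_form (gen_op g (?w w)))"
      by (simp add: right_diff_distrib)
    also have "\<dots> \<in> pres_ideal"
      by (intro fm.subspace_add subspace_ideal_gen ideal_gen_mult_left Cons straighten_gen_op)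
    finally show ?case .
  qed
  then have "p \<bind> (\<lambda>w. bas w - normal_form (?w w)) \<in> pres_ideal"
    by (intro lin_mem_subspace) auto
  then show ?thesis
    by (simp add: lin_diff_right pres_map_def normal_form_def lin_assoc)
qed

lemma pres_map_rel_iff: "pres_map p \<in> heis_rel \<longleftrightarrow> p \<in> pres_ideal"
proof
  assume "pres_map p \<in> heis_rel"
  then have "(p - normal_form (pres_map p)) + normal_form (pres_map p) \<in> pres_ideal"
    by (intro fm.subspace_add subspace_ideal_gen straighten normal_form_rel)
  then show "p \<in> pres_ideal" by simp
qed (rule pres_map_rel)

lemma braid_inv_heis_braiding: "braid_inv q deg_x deg_x = heis_braiding inv_weight"
  by (simp add: braid_inv_eq bichar_minus_left inv_weight_def[abs_def])

lemma heis_presented_braid_inv: "heis_presented q pr (braid_inv q deg_x deg_x)"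
proof -
  have "\<exists>\<Psi> \<in> ring_iso (quot_alg pres_ideal (*) 1) (quot_alg heis_rel hmul\<^sub>0 (tens 1 1)).
    (\<forall>c. \<forall>a \<in> carrier (quot_alg pres_ideal (*) 1).
       \<Psi> (c \<odot>\<^bsub>quot_alg pres_ideal (*) 1\<^esub> a) = c \<odot>\<^bsub>quot_alg heis_rel hmul\<^sub>0 (tens 1 1)\<^esub> \<Psi> a) \<and>
    (\<forall>p. \<Psi> (cls pres_ideal p) = cls heis_rel (pres_map p))"
  proof (rule quot_alg_iso[OF bilinear_compat_ideal_gen bilinear_compat_hmul module_hom_pres_map
        pres_map_mult _ pres_map_rel_iff])
    show "pres_map 1 = tens 1 1" by (simp add: one_eq_bas pres_map_def)
    show "surj pres_map" by (metis pres_map_normal_form surjI)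
  qed
  moreover have "pres_map (bas [X i]) = tens (bas [i]) 1" for i
    by (simp add: one_eq_bas pres_map_def gen_op_def)
  moreover have "pres_map (bas [D i]) = tens 1 (bas [i])" for i
    by (simp add: one_eq_bas pres_map_def gen_op_def dmul0_single skew_step_def ract_Nil_right)
  ultimately show ?thesis
    unfolding heis_presented_def pres_alg_def heis_def heis_x_def heis_d_def braid_inv_heis_braiding
    by metis
qed

end

section \<open>The braiding in place of its inverse\<close>

lemma lookup_lin:
  "Poly_Mapping.lookup (p \<bind> f) k =
    (\<Sum>b\<in>Poly_Mapping.keys p. Poly_Mapping.lookup p b * Poly_Mapping.lookup (f b) k)"
  by (simp add: lin_def lookup_sum)

lemma lookup_tens:
  "Poly_Mapping.lookup (tens p p') (a, b) = Poly_Mapping.lookup p a * Poly_Mapping.lookup p' b"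
proof -
  have 1: "Poly_Mapping.lookup (tens (bas c) p') (a, b) = (if c = a then Poly_Mapping.lookup p' b else 0)" for c
  proof -
    have "Poly_Mapping.lookup (tens (bas c) p') (a, b) =
        (\<Sum>d\<in>Poly_Mapping.keys p'. if d = b then (if c = a then Poly_Mapping.lookup p' b else 0) else 0)"
      unfolding tens_bas_left lookup_lin by (rule sum.cong) (auto simp: lookup_single when_def)
    then show ?thesis by (simp add: in_keys_iff)
  qed
  have "Poly_Mapping.lookup (tens p p') (a, b) =
      (\<Sum>c\<in>Poly_Mapping.keys p. if c = a then Poly_Mapping.lookup p a * Poly_Mapping.lookup p' b else 0)"
    unfolding tens_eq_lin[of p p'] lookup_lin 1 by (rule sum.cong) auto
  then show ?thesis by (simp add: in_keys_iff)
qed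

lemma subspace_lookup_zero: "fm.subspace {p. Poly_Mapping.lookup p k = 0}"
  by (rule fm.subspaceI) (simp_all add: lookup_add)

lemma module_hom_id_scl: "module_hom scl scl (\<lambda>p. p)"
  by unfold_locales auto

context braiding
begin

text \<open>The assumption extends \<open>q_swap\<close> to the diagonal; after exchanging the
  indices of the second double product the factors cancel in pairs.\<close>

lemma bichar_swap:
  assumes "\<And>i. q i i ^ 2 = 1"
  shows "\<chi> d d' * \<chi> d' d = 1"
proof -
  have q: "q i j * q j i = 1" for i j
    using assms[of i] q_swap[of i j] by (cases "i = j") (auto simp: power2_eq_square)
  have "\<chi> d d' * \<chi> d' d = (\<Prod>i\<in>UNIV. \<Prod>j\<in>UNIV. unit_powi (q i j) (d i * d' j)) *
      (\<Prod>i\<in>UNIV. \<Prod>j\<in>UNIV. unit_powi (q j i) (d' j * d i))"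
    unfolding bichar_def by (subst (2) prod.swap) simp
  also have "\<dots> = (\<Prod>i\<in>UNIV. \<Prod>j\<in>UNIV. unit_powi (q i j * q j i) (d i * d' j))"
    by (simp add: unit_powi_mult_base[OF q_unit q_unit] prod.distrib mult.commute[of "d' _"])
  finally show ?thesis by (simp add: q)
qed

lemma braid_eq_braid_inv:
  assumes "\<And>i. q i i ^ 2 = 1"
  shows "braid q \<delta> \<delta>' = braid_inv q \<delta> \<delta>'"
proof -
  have "unit_inv (\<chi> d' d) = \<chi> d d'" for d d'
    by (rule unit_inv_eqI) (rule bichar_swap[OF assms])
  then show ?thesis by (simp add: braid_def braid_inv_def)
qed

text \<open>Every word in a multiple of a relation contains two distinct adjacent letters, so it is
  never a power of one letter. Coefficients of such powers are thus invariants of the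
  quotient.\<close>

lemma lookup_sq_ideal_replicate:
  assumes \<delta>: "\<delta> \<in> {deg_x, deg_d}" and p: "p \<in> sq_ideal q \<delta>"
  shows "Poly_Mapping.lookup p (replicate n i) = 0"
proof -
  have "p \<in> {p. Poly_Mapping.lookup p (replicate n i) = 0}"
    using module_hom_id_scl subspace_lookup_zero _ p[unfolded sq_ideal_eq[OF \<delta>]]
  proof (rule module_hom_ideal_gen)
    fix u s v assume "s \<in> {sq_rel j k | j k. j \<noteq> k}"
    then obtain j k where s: "s = sq_rel j k" and jk: "j \<noteq> k" by auto
    have ne: "u @ a # b # v \<noteq> replicate n i" if "a \<noteq> b" for a b
    proof
      assume *: "u @ a # b # v = replicate n i"
      have "set (u @ a # b # v) \<subseteq> {i}" unfolding * by auto
      with that show False by auto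
    qed
    have "bas u * s * bas v = bas (u @ j # k # v) - scl (q j k) (bas (u @ k # j # v))"
      by (simp add: s left_diff_distrib right_diff_distrib)
    with ne[OF jk] ne[OF jk[symmetric]]
    show "bas u * s * bas v \<in> {p. Poly_Mapping.lookup p (replicate n i) = 0}"
      by (simp add: lookup_minus lookup_single when_def)
  qed
  then show ?thesis by simp
qed

end

context hopf_paired
begin

lemma lookup_heis_rel_replicate:
  assumes "P \<in> heis_rel"
  shows "Poly_Mapping.lookup P (replicate n i, []) = 0"
proof -
  have "P \<in> {P. Poly_Mapping.lookup P (replicate n i, []) = 0}"
    using module_hom_id_scl subspace_lookup_zero _ _ assms
  proof (rule module_hom_tens_rel)
    show "tens p (bas b) \<in> {P. Poly_Mapping.lookup P (replicate n i, []) = 0}"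
      if "p \<in> sq_ideal q deg_x" for p b
      using lookup_sq_ideal_replicate[OF _ that, of n i] by (simp add: lookup_tens)
    \<comment> \<open>The empty second component is the case \<open>n = 0\<close> of the coefficient
      lemma.\<close>
    show "tens (bas a) p' \<in> {P. Poly_Mapping.lookup P (replicate n i, []) = 0}"
      if "p' \<in> sq_ideal q deg_d" for a p'
      using lookup_sq_ideal_replicate[OF _ that, of 0 i] by (simp add: lookup_tens)
  qed
  then show ?thesis by simp
qed

section \<open>Computations in the double for the braiding itself\<close>

lemma heis_mult:
  "cls heis_rel P \<otimes>\<^bsub>heis q pr (heis_braiding b)\<^esub> cls heis_rel P' = cls heis_rel (hmul b P P')"
  unfolding heis_def by (rule quot_alg_mult[OF bilinear_compat_hmul])

lemma heis_module_ops:
  "cls heis_rel P \<oplus>\<^bsub>heis q pr \<beta>\<^esub> cls heis_rel P' = cls heis_rel (P + P')"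
  "c \<odot>\<^bsub>heis q pr \<beta>\<^esub> cls heis_rel P = cls heis_rel (scl c P)"
  "\<one>\<^bsub>heis q pr \<beta>\<^esub> = cls heis_rel (bas ([], []))"
  "\<zero>\<^bsub>heis q pr \<beta>\<^esub> = cls heis_rel 0"
  unfolding heis_def by (simp_all add: quot_alg_simps one_eq_bas)

lemma heis_x_eq: "heis_x q i = cls heis_rel (bas ([i], []))"
  by (simp add: heis_x_def one_eq_bas)

lemma heis_d_eq: "heis_d q i = cls heis_rel (bas ([], [i]))"
  by (simp add: heis_d_def one_eq_bas)

lemma hmul_x:
  assumes "\<And>d. b d 0 = 1"
  shows "hmul b (bas (h, [])) P = lmul (bas h) P"
  by (simp add: hmul_bas dmul_Nil[of b, OF assms])

lemma hmul_d:
  assumes "\<And>d. b d 0 = 1"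
  shows "hmul b (bas (h, [i])) (bas (k, g)) = lmul (bas h) (tens (act b [i] k) (bas g)) +
    scl (\<chi> (deg_d i) (deg deg_x k)) (bas (h @ k, i # g))"
  by (simp add: hmul_bas dmul_single[of b, OF assms])

lemma act_single_single: "act \<chi> [i] [j] = scl (if i = j then 1 else 0) (bas [])"
  by (simp add: act_def comul_Cons comul_Nil pr_single pr_Nil_right)

text \<open>The relations involve the action only on words of length at most one. There one
  coproduct factor is empty, so the weight is 1 and the choice of braiding is invisible.\<close>

lemma heis_relations_braid: "heis_relations q pr (braid q deg_x deg_x)"
proof -
  have xx: "bas ([i, j], []) - scl (q i j) (bas ([j, i], [])) \<in> heis_rel" if "i \<noteq> j" for i j
    using tens_rel_left[OF sq_rel_mem[of deg_x i j], of "bas []"] that by simp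
  have dd: "bas ([], [i, j]) - scl (q i j) (bas ([], [j, i])) \<in> heis_rel" if "i \<noteq> j" for i j
    using tens_rel_right[OF sq_rel_mem[of deg_d i j], of "bas []"] that by simp
  note simps = heis_x_eq heis_d_eq heis_mult hmul_x hmul_d act_Nil_right heis_module_ops
  show ?thesis
    unfolding heis_relations_def Let_def braid_eq
  proof (intro conjI allI impI)
    show "heis_x q i \<otimes>\<^bsub>heis q pr (heis_braiding \<chi>)\<^esub> heis_x q j =
        q i j \<odot>\<^bsub>heis q pr (heis_braiding \<chi>)\<^esub> (heis_x q j \<otimes>\<^bsub>heis q pr (heis_braiding \<chi>)\<^esub> heis_x q i)"
      if "i \<noteq> j" for i j
      by (simp add: simps cls_eq_iff xx that)
    show "heis_d q i \<otimes>\<^bsub>heis q pr (heis_braiding \<chi>)\<^esub> heis_d q j =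
        q i j \<odot>\<^bsub>heis q pr (heis_braiding \<chi>)\<^esub> (heis_d q j \<otimes>\<^bsub>heis q pr (heis_braiding \<chi>)\<^esub> heis_d q i)"
      if "i \<noteq> j" for i j
      by (simp add: simps cls_eq_iff dd that)
    show "heis_d q i \<otimes>\<^bsub>heis q pr (heis_braiding \<chi>)\<^esub> heis_x q j =
        unit_inv (q i j) \<odot>\<^bsub>heis q pr (heis_braiding \<chi>)\<^esub> (heis_x q j \<otimes>\<^bsub>heis q pr (heis_braiding \<chi>)\<^esub> heis_d q i)
        \<oplus>\<^bsub>heis q pr (heis_braiding \<chi>)\<^esub>
        (if i = j then \<one>\<^bsub>heis q pr (heis_braiding \<chi>)\<^esub> else \<zero>\<^bsub>heis q pr (heis_braiding \<chi>)\<^esub>)" for i j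
      by (simp add: simps act_single_single one_eq_bas add.commute)
  qed
qed

text \<open>The presented algebra is associative, and associativity transports along a surjective
  multiplicative map.\<close>

lemma heis_presented_assoc:
  assumes "heis_presented q pr (heis_braiding b)"
  shows "hmul b (hmul b P Q) R - hmul b P (hmul b Q R) \<in> heis_rel"
proof -
  let ?A = "pres_alg q" and ?B = "heis q pr (heis_braiding b)"
  from assms obtain \<Psi> where \<Psi>: "\<Psi> \<in> ring_iso ?A ?B" unfolding heis_presented_def by blast
  have mult: "\<Psi> (x \<otimes>\<^bsub>?A\<^esub> y) = \<Psi> x \<otimes>\<^bsub>?B\<^esub> \<Psi> y" if "x \<in> carrier ?A" "y \<in> carrier ?A" for x y
    using \<Psi> that by (simp add: ring_iso_def ring_hom_def)
  have sur: "\<exists>p. cls heis_rel P = \<Psi> (cls pres_ideal p)" for P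
  proof -
    have "cls heis_rel P \<in> carrier ?B" by (simp add: heis_def quot_alg_carrier)
    also have "carrier ?B = \<Psi> ` carrier ?A" using \<Psi> by (auto simp: ring_iso_def bij_betw_def)
    finally show ?thesis by (auto simp: pres_alg_def quot_alg_carrier)
  qed
  have car: "cls pres_ideal p \<in> carrier ?A" for p by (simp add: pres_alg_def quot_alg_carrier)
  have Amult: "cls pres_ideal p \<otimes>\<^bsub>?A\<^esub> cls pres_ideal p' = cls pres_ideal (p * p')" for p p'
    unfolding pres_alg_def by (rule quot_alg_mult[OF bilinear_compat_ideal_gen])
  obtain p r s where p: "cls heis_rel P = \<Psi> (cls pres_ideal p)"
    and r: "cls heis_rel Q = \<Psi> (cls pres_ideal r)" and s: "cls heis_rel R = \<Psi> (cls pres_ideal s)"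
    using sur by meson
  have "cls heis_rel (hmul b (hmul b P Q) R) = cls heis_rel (hmul b P (hmul b Q R))"
    unfolding heis_mult[symmetric] p r s mult[OF car car, symmetric] Amult by (simp add: mult.assoc)
  then show ?thesis by (simp add: cls_eq_iff)
qed

text \<open>The factor \<open>1 + q i i\<close> comes from the coproduct; the extra
  \<open>q i i\<close> is the braiding weight, which the inverse braiding would invert.\<close>

lemma act_square: "act \<chi> [i] [i, i] = scl (q i i * (1 + q i i)) (bas [i])"
proof -
  have "pr [i] [i, i] = 0" using pr_nonzero_length[of "[i]" "[i, i]"] by auto
  then show ?thesis
    by (simp add: act_def comul_Cons comul_Nil pr_single pr_Nil_right algebra_simps)
qed

lemma act_cube: "act \<chi> [i] [i, i, i] = scl (q i i ^ 2 * (1 + q i i + q i i ^ 2)) (bas [i, i])"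
proof -
  have "pr [i] [i, i] = 0" "pr [i] [i, i, i] = 0"
    using pr_nonzero_length[of "[i]" "[i, i]"] pr_nonzero_length[of "[i]" "[i, i, i]"] by auto
  moreover have "\<chi> (deg_x i * 2) (deg_x i) = q i i * q i i" "\<chi> (deg_x i) (deg_x i * 2) = q i i * q i i"
    by (simp_all only: mult_2_right bichar_add_left bichar_add_right bichar_deg_x)
  ultimately show ?thesis
    by (simp add: act_def comul_Cons comul_Nil pr_single pr_Nil_right algebra_simps power2_eq_square)
qed

text \<open>
  With \<open>Q = q\<^sub>i\<^sub>i\<close>, associativity of \<open>\<partial> x x\<close> only gives \<open>(Q\<^sup>2 - 1)(1 + Q) = 0\<close>, which over a ring with
  nilpotents does not imply \<open>Q\<^sup>2 = 1\<close>; together with \<open>\<partial> x x\<^sup>2\<close> it gives \<open>2 (Q\<^sup>2 - 1) = 0\<close>.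
\<close>

lemma q_diag_of_heis_presented:
  assumes pres: "heis_presented q pr (braid q deg_x deg_x)" and two: "t * 2 = (1 :: 'r)"
  shows "q i i ^ 2 = 1"
proof -
  let ?Q = "q i i" and ?v = "unit_inv (q i i)"
  note assoc = heis_presented_assoc[OF pres[unfolded braid_eq]]
  note simps = hmul_x hmul_d hmul_add_left hmul_scl_left act_single_single act_square act_cube lmul_tens
    lookup_add lookup_minus lookup_single when_def bichar_add_right
  have Qv: "?Q * ?v = 1" by (rule unit_inv_right[OF q_unit])
  have dx: "hmul \<chi> (bas ([], [i])) (bas ([i], [])) = scl ?v (bas ([i], [i])) + bas ([], [])"
    by (simp add: hmul_d act_single_single)
  have "Poly_Mapping.lookup (hmul \<chi> (hmul \<chi> (bas ([], [i])) (bas ([i], []))) (bas ([i], [])) -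
      hmul \<chi> (bas ([], [i])) (hmul \<chi> (bas ([i], [])) (bas ([i], [])))) (replicate 1 i, []) = 0"
    by (rule lookup_heis_rel_replicate[OF assoc])
  then have A: "?v + 1 = ?Q * (1 + ?Q)"
    unfolding dx by (simp add: simps)
  have "Poly_Mapping.lookup (hmul \<chi> (hmul \<chi> (bas ([], [i])) (bas ([i], []))) (bas ([i, i], [])) -
      hmul \<chi> (bas ([], [i])) (hmul \<chi> (bas ([i], [])) (bas ([i, i], [])))) (replicate 2 i, []) = 0"
    by (rule lookup_heis_rel_replicate[OF assoc])
  then have B: "?v * (?Q * (1 + ?Q)) + 1 = ?Q ^ 2 * (1 + ?Q + ?Q ^ 2)"
    unfolding dx by (simp add: simps numeral_2_eq_2)
  have A': "(?Q ^ 2 - 1) * (1 + ?Q) = 0"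
  proof -
    have "(?Q ^ 2 - 1) * (1 + ?Q) = ?Q * (?Q * (1 + ?Q)) - (1 + ?Q)"
      by (simp add: algebra_simps power2_eq_square)
    also have "\<dots> = ?Q * ?v + ?Q - (1 + ?Q)"
      unfolding A[symmetric] by (simp add: distrib_left)
    finally show ?thesis by (simp add: Qv)
  qed
  have "?v * (?Q * (1 + ?Q)) = 1 + ?Q"
    using Qv by (simp only: mult.commute[of ?v] mult.assoc[symmetric] mult_1_left)
  with B have "2 + ?Q = ?Q ^ 2 * (1 + ?Q + ?Q ^ 2)" by (simp add: add_ac)
  moreover have "(?Q ^ 2 - 1) * (1 + ?Q) * ?Q + 2 * (?Q ^ 2 - 1) =
      ?Q ^ 2 * (1 + ?Q + ?Q ^ 2) - (2 + ?Q)"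
    by (simp add: algebra_simps power2_eq_square)
  ultimately have "(?Q ^ 2 - 1) * (1 + ?Q) * ?Q + 2 * (?Q ^ 2 - 1) = 0" by simp
  then have "t * 2 * (?Q ^ 2 - 1) = 0" by (simp add: A' mult.assoc)
  then show ?thesis by (simp add: two)
qed

end

theorem proposition3p9:
  fixes \<phi> :: "'k::{alg_closed_field, field_char_0} \<Rightarrow> 'r::comm_ring_1"
    and q :: "'n::finite \<Rightarrow> 'n \<Rightarrow> 'r"
    and pr :: "'n list \<Rightarrow> 'n list \<Rightarrow> 'r"
  assumes coeff: "\<phi> 1 = 1" "\<And>a b. \<phi> (a + b) = \<phi> a + \<phi> b" "\<And>a b. \<phi> (a * b) = \<phi> a * \<phi> b"
    and q_unit: "\<And>i j. q i j dvd 1"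
    and q_skew: "\<And>i j. i \<noteq> j \<Longrightarrow> q j i = unit_inv (q i j)"
    and pairing: "hopf_pairing q pr"
  shows "heis_presented q pr (braid_inv q deg_x deg_x) \<and>
    heis_relations q pr (braid q deg_x deg_x) \<and>
    (heis_presented q pr (braid q deg_x deg_x) \<longleftrightarrow> (\<forall>i. q i i ^ 2 = 1))"
proof -
  interpret hopf_paired q pr
    using q_unit q_skew pairing by unfold_locales
  \<comment> \<open>The image of 1/2 inverts 2 among the coefficients; this is where characteristic
    zero enters.\<close>
  have "\<phi> (1 / 2) * 2 = \<phi> (1 / 2) * \<phi> (1 + 1)" by (simp only: coeff(1,2)) simp
  also have "\<dots> = \<phi> 1" unfolding coeff(3)[symmetric] by simp
  finally have two: "\<phi> (1 / 2) * 2 = 1" by (simp add: coeff(1))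
  show ?thesis
    using heis_presented_braid_inv heis_relations_braid q_diag_of_heis_presented[OF _ two]
      braid_eq_braid_inv[of deg_x deg_x] by metis
qed

end
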